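(* Run SPIDER-ADMM (described in the context) with $b=q$, $\eta=\frac{2\alpha\sigma_{\min}(G)}{3L}$ $(0<\alpha\le1)$ and $\rho=\frac{\sqrt{170}\,\kappa_GL}{\sigma^A_{\min}\alpha}$. Then SPIDER-ADMM has an $O(1/K)$ convergence rate. Moreover, given $b=q=\sqrt n$, $\eta=\frac{2\alpha\sigma_{\min}(G)}{3L}$ $(0<\alpha\le1)$ and $\rho=\frac{\sqrt{170}\,\kappa_GL}{\sigma^A_{\min}\alpha}$, SPIDER-ADMM has the optimal incremental first-order oracle (IFO) complexity of $\mathcal{O}(n+n^{1/2}\epsilon^{-1})$ for finding an $\epsilon$-approximate stationary point. In particular, $\alpha\in(0,1]$ can be chosen according to the problem to obtain an appropriate step size $\eta$ and penalty parameter $\rho$; e.g. $\alpha=1$ gives $\eta=\frac{2\sigma_{\min}(G)}{3L}$ and $\rho=\frac{\sqrt{170}\,\kappa_GL}{\sigma^A_{\min}}$.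
   Context: Problem: minimize $f(x)+\sum_{j=1}^m g_j(y_j)$ subject to $Ax+\sum_{j=1}^m B_jy_j=c$, where $f=\frac1n\sum_{i=1}^n f_i$ with $f_i:\mathbb{R}^d\to\mathbb{R}$, $f$ smooth and nonconvex, $g_j:\mathbb{R}^p\to\mathbb{R}$ convex and possibly nonsmooth, $A\in\mathbb{R}^{l\times d}$, $B_j\in\mathbb{R}^{l\times p}$, $c\in\mathbb{R}^l$, $m\ge1$. Assumptions: each $f_i$ is $L$-smooth ($\|\nabla f_i(x)-\nabla f_i(y)\|\le L\|x-y\|$ for all $x,y$); $\|\nabla f(x)\|^2\le\delta^2$ for all $x$, for some $\delta>0$; $f$ and all $g_j$ are bounded below; $A$ has full column rank. Notation: $y_{[m]}=(y_1,\dots,y_m)$, $y_{[i:j]}=(y_i,\dots,y_j)$, $y_{[j]}=(y_1,\dots,y_j)$; $\|x\|_G^2=x^TGx$; $\sigma_{\max}(G),\sigma_{\min}(G)$ are the largest and smallest eigenvalues of $G$, $\kappa_G=\sigma_{\max}(G)/\sigma_{\min}(G)$; $\sigma^A_{\min}$ is the smallest eigenvalue of $A^TA$. $\sqrt n$ is treated as an integer. Lagrangian: $L(x,y_{[m]},z)=f(x)+\sum_j g_j(y_j)-\langle z,Ax+\sum_jB_jy_j-c\rangle$; $\partial L(x,y_{[m]},z)$ is the set of stacked vectors with blocks $\nabla_xL$, $\partial_{y_1}L,\dots,\partial_{y_m}L$ and $-Ax-\sum_jB_jy_j+c$; $\mathrm{dist}(0,\partial L)=\inf_{L'\in\partial L}\|L'\|$.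 A (random) point is an $\epsilon$-approximate stationary point if $\mathbb{E}[\mathrm{dist}(0,\partial L)^2]\le\epsilon$ there. Augmented Lagrangian: $\mathcal{L}_\rho(x,y_{[m]},z)=L(x,y_{[m]},z)+\frac\rho2\|Ax+\sum_jB_jy_j-c\|^2$. SPIDER-ADMM: inputs are positive integers $b,q,K$, $\eta,\rho>0$, positive definite matrices $G$ and $H_1,\dots,H_m$, and initial points $x_0,y_j^0,z_0$. For $k=0,1,\dots,K-1$: if $k\equiv0\pmod q$ set $v_k=\nabla f(x_k)$; otherwise draw a mini-batch $\mathcal{I}_k$ of $b$ indices uniformly with replacement from $\{1,\dots,n\}$ and set $v_k=\frac1b\sum_{i\in\mathcal{I}_k}(\nabla f_i(x_k)-\nabla f_i(x_{k-1}))+v_{k-1}$. Then successively for $j=1,\dots,m$, $y_j^{k+1}=\arg\min_{y_j}\{\mathcal{L}_\rho(x_k,y^{k+1}_{[j-1]},y_j,y^k_{[j+1:m]},z_k)+\frac12\|y_j-y_j^k\|_{H_j}^2\}$; $x_{k+1}=\arg\min_x\{v_k^T(x-x_k)+\frac1{2\eta}\|x-x_k\|_G^2-z_k^T(Ax+\sum_jB_jy_j^{k+1}-c)+\frac\rho2\|Ax+\sum_jB_jy_j^{k+1}-c\|^2\}$; $z_{k+1}=z_k-\rho(Ax_{k+1}+\sum_jB_jy_j^{k+1}-c)$. Output (in theory): an iterate $(x_k,y_{[m]}^k,z_k)$ with $k$ uniform in $\{1,\dots,K\}$. The $O(1/K)$ convergence rate means $\frac1K\sum_{k=1}^K\mathbb{E}[\mathrm{dist}(0,\partial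 L(x_k,y_{[m]}^k,z_k))^2]=O(1/K)$. IFO complexity: the number of calls to an oracle which, given $(i,x)$, returns $(f_i(x),\nabla f_i(x))$. The $O$-notation hides factors independent of $n$, $K$ and $\epsilon$ (the problem constants, matrix eigenvalues, $m$, $\alpha$ and the initial gap are treated as constants).
   Formalization: Added assumption: for every y_[m] some x satisfies Ax+∑B_j y_j=c (ranges of B_j and c lie in the range of A). Full column rank of A alone does not suffice: with A=(1,0)^T, B=0, c=(0,1)^T the residual never vanishes. "Optimal" is read as the stated upper bound only. *)

theory Defs
  imports "HOL-Probability.Probability"
begin

section \<open>Matrices\<close>

text \<open>Positive definite matrices are symmetric by convention; the spectrum of a symmetric real matrix
  is finite and nonempty, so \<open>Max\<close> and \<open>Min\<close> below are meaningful.\<close>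

definition pos_def :: "real^'n^'n \<Rightarrow> bool" where
  "pos_def G \<longleftrightarrow> transpose G = G \<and> (\<forall>x. x \<noteq> 0 \<longrightarrow> 0 < x \<bullet> (G *v x))"

definition eigenvalues :: "real^'n^'n \<Rightarrow> real set" where
  "eigenvalues G = {l. \<exists>v. v \<noteq> 0 \<and> G *v v = l *\<^sub>R v}"

definition sigma_max :: "real^'n^'n \<Rightarrow> real" where
  "sigma_max G = Max (eigenvalues G)"

definition sigma_min :: "real^'n^'n \<Rightarrow> real" where
  "sigma_min G = Min (eigenvalues G)"

definition kappa :: "real^'n^'n \<Rightarrow> real" where
  "kappa G = sigma_max G / sigma_min G"

definition wnorm_sq :: "real^'n^'n \<Rightarrow> real^'n \<Rightarrow> real" where
  "wnorm_sq G x = x \<bullet> (G *v x)"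


section \<open>Gradients and subdifferentials\<close>

definition gradient :: "('a::real_inner \<Rightarrow> real) \<Rightarrow> 'a \<Rightarrow> 'a" where
  "gradient f x = (THE D. GDERIV f x :> D)"

definition L_smooth :: "real \<Rightarrow> ('a::real_inner \<Rightarrow> real) \<Rightarrow> bool" where
  "L_smooth L f \<longleftrightarrow> (\<forall>x. f differentiable (at x)) \<and>
     (\<forall>x y. norm (gradient f x - gradient f y) \<le> L * norm (x - y))"

definition subdifferential :: "('a::real_inner \<Rightarrow> real) \<Rightarrow> 'a \<Rightarrow> 'a set" where
  "subdifferential g y = {s. \<forall>u. g u \<ge> g y + s \<bullet> (u - y)}"


section \<open>The problem and its stationarity measure\<close>

text \<open>Component functions are indexed by \<open>1..n\<close> and blocks by \<open>1..m\<close>; the values of \<open>fi\<close>, \<open>g\<close>, \<open>B\<close>,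
  \<open>H\<close> and of a block vector \<open>y\<close> at other indices are irrelevant.\<close>

definition favg :: "nat \<Rightarrow> (nat \<Rightarrow> real^'d \<Rightarrow> real) \<Rightarrow> real^'d \<Rightarrow> real" where
  "favg n fi x = (1 / real n) * (\<Sum>i=1..n. fi i x)"

definition residual ::
  "nat \<Rightarrow> real^'d^'l \<Rightarrow> (nat \<Rightarrow> real^'p^'l) \<Rightarrow> real^'l \<Rightarrow> real^'d \<Rightarrow> (nat \<Rightarrow> real^'p) \<Rightarrow> real^'l" where
  "residual m A B c x y = A *v x + (\<Sum>j=1..m. B j *v y j) - c"

text \<open>Full column rank of \<open>A\<close> alone gives \<open>sigma_min (A\<^sup>T A) \<cdot> \<parallel>u\<parallel>\<^sup>2 \<le> \<parallel>A\<^sup>T u\<parallel>\<^sup>2\<close> only for \<open>u\<close> in the range of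
  \<open>A\<close>. The analysis needs it for the multiplier increments, which are multiples of residuals. Hence the
  hypothesis that for every \<open>y\<close> the constraint is solvable in \<open>x\<close>; it is automatic for square \<open>A\<close>.\<close>

definition lagrangian ::
  "(real^'d \<Rightarrow> real) \<Rightarrow> (nat \<Rightarrow> real^'p \<Rightarrow> real) \<Rightarrow> nat \<Rightarrow> real^'d^'l \<Rightarrow> (nat \<Rightarrow> real^'p^'l) \<Rightarrow> real^'l
   \<Rightarrow> real^'d \<Rightarrow> (nat \<Rightarrow> real^'p) \<Rightarrow> real^'l \<Rightarrow> real" where
  "lagrangian f g m A B c x y z = f x + (\<Sum>j=1..m. g j (y j)) - z \<bullet> residual m A B c x y"

definition aug_lagrangian ::
  "real \<Rightarrow> (real^'d \<Rightarrow> real) \<Rightarrow> (nat \<Rightarrow> real^'p \<Rightarrow> real) \<Rightarrow> nat \<Rightarrow> real^'d^'l \<Rightarrow> (nat \<Rightarrow> real^'p^'l) \<Rightarrow> real^'l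
   \<Rightarrow> real^'d \<Rightarrow> (nat \<Rightarrow> real^'p) \<Rightarrow> real^'l \<Rightarrow> real" where
  "aug_lagrangian \<rho> f g m A B c x y z =
     lagrangian f g m A B c x y z + \<rho> / 2 * (norm (residual m A B c x y))\<^sup>2"

text \<open>A stacked vector is a triple: the \<open>x\<close>-block, the family of \<open>y\<close>-blocks, the \<open>z\<close>-block.\<close>

definition partial_lagrangian ::
  "(real^'d \<Rightarrow> real) \<Rightarrow> (nat \<Rightarrow> real^'p \<Rightarrow> real) \<Rightarrow> nat \<Rightarrow> real^'d^'l \<Rightarrow> (nat \<Rightarrow> real^'p^'l) \<Rightarrow> real^'l
   \<Rightarrow> real^'d \<Rightarrow> (nat \<Rightarrow> real^'p) \<Rightarrow> real^'l \<Rightarrow> ((real^'d) \<times> (nat \<Rightarrow> real^'p) \<times> (real^'l)) set" where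
  "partial_lagrangian f g m A B c x y z =
     {(u, w, r).
        u = gradient (\<lambda>x'. lagrangian f g m A B c x' y z) x \<and>
        (\<forall>j\<in>{1..m}. w j \<in> subdifferential (\<lambda>t. lagrangian f g m A B c x (y(j := t)) z) (y j)) \<and>
        r = - (A *v x) - (\<Sum>j=1..m. B j *v y j) + c}"

definition stacked_norm :: "nat \<Rightarrow> ((real^'d) \<times> (nat \<Rightarrow> real^'p) \<times> (real^'l)) \<Rightarrow> real" where
  "stacked_norm m = (\<lambda>(u, w, r). sqrt ((norm u)\<^sup>2 + (\<Sum>j=1..m. (norm (w j))\<^sup>2) + (norm r)\<^sup>2))"

definition dist_stationary ::
  "(real^'d \<Rightarrow> real) \<Rightarrow> (nat \<Rightarrow> real^'p \<Rightarrow> real) \<Rightarrow> nat \<Rightarrow> real^'d^'l \<Rightarrow> (nat \<Rightarrow> real^'p^'l) \<Rightarrow> real^'l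
   \<Rightarrow> real^'d \<Rightarrow> (nat \<Rightarrow> real^'p) \<Rightarrow> real^'l \<Rightarrow> real" where
  "dist_stationary f g m A B c x y z =
     (INF v\<in>partial_lagrangian f g m A B c x y z. stacked_norm m v)"

definition expected_sq_dist ::
  "(real^'d \<Rightarrow> real) \<Rightarrow> (nat \<Rightarrow> real^'p \<Rightarrow> real) \<Rightarrow> nat \<Rightarrow> real^'d^'l \<Rightarrow> (nat \<Rightarrow> real^'p^'l) \<Rightarrow> real^'l
   \<Rightarrow> ((real^'d) \<times> (nat \<Rightarrow> real^'p) \<times> (real^'l)) pmf \<Rightarrow> real" where
  "expected_sq_dist f g m A B c P =
     measure_pmf.expectation P (\<lambda>(x, y, z). (dist_stationary f g m A B c x y z)\<^sup>2)"

definition approx_stationary ::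
  "real \<Rightarrow> (real^'d \<Rightarrow> real) \<Rightarrow> (nat \<Rightarrow> real^'p \<Rightarrow> real) \<Rightarrow> nat \<Rightarrow> real^'d^'l \<Rightarrow> (nat \<Rightarrow> real^'p^'l) \<Rightarrow> real^'l
   \<Rightarrow> ((real^'d) \<times> (nat \<Rightarrow> real^'p) \<times> (real^'l)) pmf \<Rightarrow> bool" where
  "approx_stationary \<epsilon> f g m A B c P \<longleftrightarrow> expected_sq_dist f g m A B c P \<le> \<epsilon>"

definition standing_assumptions ::
  "real \<Rightarrow> real \<Rightarrow> nat \<Rightarrow> (nat \<Rightarrow> real^'d \<Rightarrow> real) \<Rightarrow> nat \<Rightarrow> (nat \<Rightarrow> real^'p \<Rightarrow> real) \<Rightarrow> bool" where
  "standing_assumptions L \<delta> n fi m g \<longleftrightarrow>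
     (\<forall>i\<in>{1..n}. L_smooth L (fi i)) \<and>
     (\<forall>x. (norm (gradient (favg n fi) x))\<^sup>2 \<le> \<delta>\<^sup>2) \<and>
     bdd_below (range (favg n fi)) \<and>
     (\<forall>j\<in>{1..m}. convex_on UNIV (g j) \<and> bdd_below (range (g j)))"

definition initial_gap ::
  "real \<Rightarrow> (real^'d \<Rightarrow> real) \<Rightarrow> (nat \<Rightarrow> real^'p \<Rightarrow> real) \<Rightarrow> nat \<Rightarrow> real^'d^'l \<Rightarrow> (nat \<Rightarrow> real^'p^'l) \<Rightarrow> real^'l
   \<Rightarrow> real^'d \<Rightarrow> (nat \<Rightarrow> real^'p) \<Rightarrow> real^'l \<Rightarrow> real" where
  "initial_gap \<rho> f g m A B c x0 y0 z0 =
     aug_lagrangian \<rho> f g m A B c x0 y0 z0 - ((INF x. f x) + (\<Sum>j=1..m. INF t. g j t))"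


section \<open>SPIDER-ADMM\<close>

text \<open>The state after \<open>k\<close> iterations holds \<open>x\<^sub>k\<^sub>-\<^sub>1\<close>, \<open>x\<^sub>k\<close>, \<open>v\<^sub>k\<^sub>-\<^sub>1\<close>, \<open>y\<^sup>k\<close>, \<open>z\<^sub>k\<close> and the number of IFO
  calls made so far.\<close>

record ('d::finite, 'p::finite, 'l::finite) spider_state =
  x_prev :: "real^'d"
  x_cur :: "real^'d"
  v_prev :: "real^'d"
  y_cur :: "nat \<Rightarrow> real^'p"
  z_cur :: "real^'l"
  ifo_calls :: nat

text \<open>The stochastic gradient \<open>v\<^sub>k\<close>, paired with the number of IFO calls spent on it: \<open>n\<close> for a full
  gradient and two per sampled index otherwise.\<close>

definition spider_estimator ::
  "nat \<Rightarrow> (nat \<Rightarrow> real^'d \<Rightarrow> real) \<Rightarrow> nat \<Rightarrow> nat \<Rightarrow> nat \<Rightarrow> ('d::finite, 'p::finite, 'l::finite) spider_state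
   \<Rightarrow> ((real^'d) \<times> nat) pmf" where
  "spider_estimator n fi b q k s =
     (if k mod q = 0 then return_pmf (gradient (favg n fi) (x_cur s), n)
      else map_pmf
        (\<lambda>is. ((1 / real b) *\<^sub>R (\<Sum>i\<leftarrow>is. gradient (fi i) (x_cur s) - gradient (fi i) (x_prev s))
                 + v_prev s, 2 * b))
        (replicate_pmf b (pmf_of_set {1..n})))"

text \<open>\<open>y_sweep \<dots> x z y j\<close> has the blocks \<open>1..j\<close> of \<open>y\<close> updated, in this order.\<close>

primrec y_sweep ::
  "real \<Rightarrow> (real^'d \<Rightarrow> real) \<Rightarrow> (nat \<Rightarrow> real^'p \<Rightarrow> real) \<Rightarrow> nat \<Rightarrow> real^'d^'l \<Rightarrow> (nat \<Rightarrow> real^'p^'l) \<Rightarrow> real^'l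
   \<Rightarrow> (nat \<Rightarrow> real^'p^'p) \<Rightarrow> real^'d \<Rightarrow> real^'l \<Rightarrow> (nat \<Rightarrow> real^'p) \<Rightarrow> nat \<Rightarrow> (nat \<Rightarrow> real^'p)" where
  "y_sweep \<rho> f g m A B c H x z y 0 = y"
| "y_sweep \<rho> f g m A B c H x z y (Suc j) =
     (let y' = y_sweep \<rho> f g m A B c H x z y j in
      y'(Suc j := (ARG_MIN (\<lambda>t. aug_lagrangian \<rho> f g m A B c x (y'(Suc j := t)) z
                             + 1 / 2 * wnorm_sq (H (Suc j)) (t - y (Suc j))) t. True)))"

definition x_update ::
  "nat \<Rightarrow> real^'d^'l \<Rightarrow> (nat \<Rightarrow> real^'p^'l) \<Rightarrow> real^'l \<Rightarrow> real \<Rightarrow> real \<Rightarrow> real^'d^'d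
   \<Rightarrow> real^'d \<Rightarrow> real^'d \<Rightarrow> (nat \<Rightarrow> real^'p) \<Rightarrow> real^'l \<Rightarrow> real^'d" where
  "x_update m A B c \<eta> \<rho> G v xk y z =
     (ARG_MIN (\<lambda>x. v \<bullet> (x - xk) + 1 / (2 * \<eta>) * wnorm_sq G (x - xk)
                    - z \<bullet> residual m A B c x y
                    + \<rho> / 2 * (norm (residual m A B c x y))\<^sup>2) x. True)"

definition spider_step ::
  "nat \<Rightarrow> (nat \<Rightarrow> real^'d \<Rightarrow> real) \<Rightarrow> (nat \<Rightarrow> real^'p \<Rightarrow> real) \<Rightarrow> nat \<Rightarrow> real^'d^'l \<Rightarrow> (nat \<Rightarrow> real^'p^'l) \<Rightarrow> real^'l
   \<Rightarrow> nat \<Rightarrow> nat \<Rightarrow> real \<Rightarrow> real \<Rightarrow> real^'d^'d \<Rightarrow> (nat \<Rightarrow> real^'p^'p)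
   \<Rightarrow> nat \<Rightarrow> ('d, 'p, 'l) spider_state \<Rightarrow> ('d, 'p, 'l) spider_state pmf" where
  "spider_step n fi g m A B c b q \<eta> \<rho> G H k s =
     do {
       (v, calls) \<leftarrow> spider_estimator n fi b q k s;
       let y' = y_sweep \<rho> (favg n fi) g m A B c H (x_cur s) (z_cur s) (y_cur s) m;
       let x' = x_update m A B c \<eta> \<rho> G v (x_cur s) y' (z_cur s);
       let z' = z_cur s - \<rho> *\<^sub>R residual m A B c x' y';
       return_pmf \<lparr>x_prev = x_cur s, x_cur = x', v_prev = v, y_cur = y', z_cur = z',
                   ifo_calls = ifo_calls s + calls\<rparr>
     }"

text \<open>Since iteration \<open>0\<close> uses a full gradient, the initial \<open>x_prev\<close> and \<open>v_prev\<close> are never read.\<close>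

primrec spider_run ::
  "nat \<Rightarrow> (nat \<Rightarrow> real^'d \<Rightarrow> real) \<Rightarrow> (nat \<Rightarrow> real^'p \<Rightarrow> real) \<Rightarrow> nat \<Rightarrow> real^'d^'l \<Rightarrow> (nat \<Rightarrow> real^'p^'l) \<Rightarrow> real^'l
   \<Rightarrow> nat \<Rightarrow> nat \<Rightarrow> real \<Rightarrow> real \<Rightarrow> real^'d^'d \<Rightarrow> (nat \<Rightarrow> real^'p^'p)
   \<Rightarrow> real^'d \<Rightarrow> (nat \<Rightarrow> real^'p) \<Rightarrow> real^'l \<Rightarrow> nat \<Rightarrow> ('d, 'p, 'l) spider_state pmf" where
  "spider_run n fi g m A B c b q \<eta> \<rho> G H x0 y0 z0 0 =
     return_pmf \<lparr>x_prev = x0, x_cur = x0, v_prev = 0, y_cur = y0, z_cur = z0, ifo_calls = 0\<rparr>"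
| "spider_run n fi g m A B c b q \<eta> \<rho> G H x0 y0 z0 (Suc k) =
     spider_run n fi g m A B c b q \<eta> \<rho> G H x0 y0 z0 k \<bind>
       spider_step n fi g m A B c b q \<eta> \<rho> G H k"

definition spider_iterate ::
  "nat \<Rightarrow> (nat \<Rightarrow> real^'d \<Rightarrow> real) \<Rightarrow> (nat \<Rightarrow> real^'p \<Rightarrow> real) \<Rightarrow> nat \<Rightarrow> real^'d^'l \<Rightarrow> (nat \<Rightarrow> real^'p^'l) \<Rightarrow> real^'l
   \<Rightarrow> nat \<Rightarrow> nat \<Rightarrow> real \<Rightarrow> real \<Rightarrow> real^'d^'d \<Rightarrow> (nat \<Rightarrow> real^'p^'p)
   \<Rightarrow> real^'d \<Rightarrow> (nat \<Rightarrow> real^'p) \<Rightarrow> real^'l \<Rightarrow> nat \<Rightarrow> ((real^'d) \<times> (nat \<Rightarrow> real^'p) \<times> (real^'l)) pmf" where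
  "spider_iterate n fi g m A B c b q \<eta> \<rho> G H x0 y0 z0 k =
     map_pmf (\<lambda>s. (x_cur s, y_cur s, z_cur s)) (spider_run n fi g m A B c b q \<eta> \<rho> G H x0 y0 z0 k)"

definition spider_output ::
  "nat \<Rightarrow> (nat \<Rightarrow> real^'d \<Rightarrow> real) \<Rightarrow> (nat \<Rightarrow> real^'p \<Rightarrow> real) \<Rightarrow> nat \<Rightarrow> real^'d^'l \<Rightarrow> (nat \<Rightarrow> real^'p^'l) \<Rightarrow> real^'l
   \<Rightarrow> nat \<Rightarrow> nat \<Rightarrow> real \<Rightarrow> real \<Rightarrow> real^'d^'d \<Rightarrow> (nat \<Rightarrow> real^'p^'p)
   \<Rightarrow> real^'d \<Rightarrow> (nat \<Rightarrow> real^'p) \<Rightarrow> real^'l \<Rightarrow> nat \<Rightarrow> ((real^'d) \<times> (nat \<Rightarrow> real^'p) \<times> (real^'l)) pmf" where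
  "spider_output n fi g m A B c b q \<eta> \<rho> G H x0 y0 z0 K =
     pmf_of_set {1..K} \<bind> spider_iterate n fi g m A B c b q \<eta> \<rho> G H x0 y0 z0"

end

theory Submission
  imports Defs
begin

text \<open>
  The augmented Lagrangian serves as a potential. The updates of the \<open>y\<close>-blocks lower it by their proximal terms
  (\<open>sweep_descent\<close>), and the \<open>x\<close>-update lowers it by \<open>\<rho> \<sigma> / 2\<close> times the squared move, up to the squared error of
  the gradient estimate (\<open>x_update_descent\<close>). The multiplier step raises it by \<open>1 / \<rho>\<close> times the squared increment of
  the multiplier. Every residual lies in the range of \<open>A\<close>, on which \<open>A\<^sup>T\<close> is bounded below, and optimality of the
  \<open>x\<close>-update expresses \<open>A\<^sup>T z\<close> by the gradient estimate and the last move. The increment is therefore controlled by two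
  consecutive moves and by the estimation error. With \<open>\<rho> \<sigma> \<ge> 13 T\<close>, \<open>T = \<kappa>\<^sub>G L / \<alpha>\<close>, the gain exceeds the loss with enough
  room to pay also for a small multiple \<open>\<zeta>\<close> of the squared stationarity measure, because that measure is itself
  bounded by moves, errors and multiplier increments (\<open>iteration_inequality\<close>).

  This inequality holds on every sample path. Randomness enters only through the estimation error, whose mean square
  grows by at most \<open>L\<^sup>2 / q\<close> times the squared move per mini-batch step of size \<open>q\<close> and returns to zero every \<open>q\<close>
  iterations. The sum of the mean squared errors is thus at most \<open>L\<^sup>2\<close> times the sum of the mean squared moves
  (\<open>reset_error_sum\<close>), whatever \<open>q\<close> is. Since the potential is bounded below up to the same quantities
  (\<open>AL_lower\<close>), everything telescopes (\<open>potential_summation\<close>): the expected squared stationarity measures over all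
  iterations have a sum bounded by a constant that depends on neither \<open>n\<close>, \<open>q\<close>, \<open>K\<close> nor the functions beyond the
  initial gap (\<open>stationarity_sum\<close>).

  Averaging over \<open>K\<close> iterations gives the rate. For accuracy \<open>\<epsilon>\<close> a number \<open>K\<close> of iterations of order \<open>1 / \<epsilon>\<close>
  suffices, and with \<open>q = sqrt n\<close> the oracle calls number at most \<open>n + 3 K sqrt n\<close> (\<open>ifo_complexity\<close>).
\<close>

section \<open>Minimisers and first-order optimality\<close>

lemma nonneg_if_nonneg_perturbation:
  fixes X Y :: real
  assumes "\<And>s. 0 < s \<Longrightarrow> s \<le> 1 \<Longrightarrow> 0 \<le> X + s * Y"
  shows "0 \<le> X"
proof (rule ccontr)
  assume "\<not> 0 \<le> X"
  hence X: "X < 0" by simp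
  define s where "s = min 1 (- X / (2 * (\<bar>Y\<bar> + 1)))"
  have s: "0 < s" "s \<le> 1" using X by (auto simp: s_def intro!: divide_pos_pos divide_neg_pos)
  have "s * Y \<le> s * (\<bar>Y\<bar> + 1)" using s by (intro mult_left_mono) auto
  also have "\<dots> \<le> (- X / (2 * (\<bar>Y\<bar> + 1))) * (\<bar>Y\<bar> + 1)"
    by (intro mult_right_mono) (auto simp: s_def)
  also have "\<dots> = - X / 2" by (simp add: field_simps)
  finally show False using assms[OF s] X by linarith
qed

text \<open>Along the segment from \<open>t\<close> to \<open>u\<close> convexity bounds \<open>g\<close> by a linear function of the step \<open>s\<close>, while \<open>\<phi>\<close> deviates
  from its linear model by \<open>O(s\<^sup>2)\<close>; divide by \<open>s\<close> and let \<open>s\<close> tend to \<open>0\<close>. A quadratic upper model of \<open>\<phi>\<close>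
  stands in for differentiability, which suits the quadratic terms of the subproblems.\<close>

lemma subgradient_of_minimiser:
  fixes g \<phi> :: "'a::real_inner \<Rightarrow> real"
  assumes g: "convex_on UNIV g"
    and min: "\<And>u. g t + \<phi> t \<le> g u + \<phi> u"
    and expand: "\<And>h. \<phi> (t + h) \<le> \<phi> t + D \<bullet> h + Q * (norm h)\<^sup>2"
  shows "- D \<in> subdifferential g t"
  unfolding subdifferential_def
proof (intro CollectI allI)
  fix u
  define h where "h = u - t"
  have "0 \<le> (g u - g t + D \<bullet> h) + s * (Q * (norm h)\<^sup>2)" if s: "0 < s" "s \<le> 1" for s
  proof -
    have eq: "(1 - s) *\<^sub>R t + s *\<^sub>R u = t + s *\<^sub>R h" by (simp add: h_def algebra_simps)
    have "g (t + s *\<^sub>R h) \<le> (1 - s) * g t + s * g u"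
      using convex_onD[OF g, of s t u] s by (simp add: eq)
    moreover have "\<phi> (t + s *\<^sub>R h) \<le> \<phi> t + s * (D \<bullet> h) + Q * (s\<^sup>2 * (norm h)\<^sup>2)"
      using expand[of "s *\<^sub>R h"] by (simp add: power_mult_distrib)
    ultimately have "0 \<le> s * ((g u - g t + D \<bullet> h) + s * (Q * (norm h)\<^sup>2))"
      using min[of "t + s *\<^sub>R h"] by (simp add: algebra_simps power2_eq_square)
    thus ?thesis using s by (simp add: zero_le_mult_iff)
  qed
  hence "0 \<le> g u - g t + D \<bullet> h" by (rule nonneg_if_nonneg_perturbation)
  thus "g t + - D \<bullet> (u - t) \<le> g u" by (simp add: h_def)
qed

lemma stationary_of_minimiser:
  fixes \<phi> :: "'a::real_inner \<Rightarrow> real"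
  assumes min: "\<And>u. \<phi> t \<le> \<phi> u"
    and expand: "\<And>h. \<phi> (t + h) \<le> \<phi> t + D \<bullet> h + Q * (norm h)\<^sup>2"
  shows "D = 0"
proof -
  have "- D \<in> subdifferential (\<lambda>_. 0) t"
    by (rule subgradient_of_minimiser[where \<phi>=\<phi> and Q=Q]) (use min expand in \<open>auto simp: convex_on_def\<close>)
  hence "0 + - D \<bullet> (t - D - t) \<le> 0" unfolding subdifferential_def by blast
  thus ?thesis by (simp add: power2_norm_eq_inner[symmetric])
qed

text \<open>The updates of the algorithm are choice operators, so their optimality properties are available only once
  a minimiser is known to exist. Outside a large ball the quadratic growth beats the value at the centre.\<close>

lemma coercive_attains_min:
  fixes h :: "'a::euclidean_space \<Rightarrow> real"
  assumes cont: "continuous_on UNIV h" and a: "0 < a"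
    and lower: "\<And>x. c + a * (norm (x - x0))\<^sup>2 - b * norm (x - x0) \<le> h x"
  shows "\<exists>t. \<forall>u. h t \<le> h u"
proof -
  define e where "e = \<bar>h x0 - c\<bar>"
  define B where "B = \<bar>b\<bar>"
  have pos: "0 \<le> e" "0 \<le> B" "b \<le> B" "h x0 \<le> c + e" by (auto simp: e_def B_def)
  define R where "R = max 1 ((B + e + 1) / a)"
  have R: "1 \<le> R" "B + e + 1 \<le> a * R"
    using a pos by (auto simp: R_def field_simps max_def split: if_splits)
  obtain t where t: "t \<in> cball x0 R" "\<And>u. u \<in> cball x0 R \<Longrightarrow> h t \<le> h u"
    using continuous_attains_inf[of "cball x0 R" h] cont R
    by (metis (no_types, lifting) compact_cball continuous_on_subset empty_iff centre_in_cball
        subset_UNIV zero_le_one order_trans)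
  have "h t \<le> h u" for u
  proof (cases "u \<in> cball x0 R")
    case False
    define r where "r = norm (u - x0)"
    have r: "R < r" using False by (simp add: r_def dist_norm norm_minus_commute)
    have "(B + e + 1) * r \<le> (a * R) * r" using R r by (intro mult_right_mono) auto
    also have "\<dots> \<le> a * r\<^sup>2" using r R a by (simp add: power2_eq_square)
    finally have 1: "B * r + e * r + r \<le> a * r\<^sup>2" by (simp add: algebra_simps)
    have 2: "b * r \<le> B * r" using r R pos by (intro mult_right_mono) auto
    have 3: "e * 1 \<le> e * r" using r R pos by (intro mult_left_mono) auto
    have "h x0 \<le> h u"
      using lower[of u, folded r_def] 1 2 3 r R pos by linarith
    moreover have "h t \<le> h x0" using t(2)[of x0] R by simp
    ultimately show ?thesis by simp
  qed (use t in auto)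
  thus ?thesis by blast
qed

lemma arg_min_le:
  fixes h :: "'a \<Rightarrow> real"
  assumes "\<exists>t. \<forall>u. h t \<le> h u"
  shows "h (ARG_MIN h x. True) \<le> h u"
proof -
  obtain t where t: "\<forall>u. h t \<le> h u" using assms by blast
  have "h (ARG_MIN h x. True) = h t" using t by (intro arg_min_equality) auto
  thus ?thesis using t by simp
qed

section \<open>Extreme eigenvalues of symmetric matrices\<close>

lemma inner_matrix_vector: "x \<bullet> (M *v y) = (transpose M *v x) \<bullet> y" for M :: "real^'n^'m"
  by (metis dot_lmul_matrix vector_transpose_matrix transpose_transpose)

lemma inner_symmetric: "transpose S = S \<Longrightarrow> x \<bullet> (S *v y) = (S *v x) \<bullet> y" for S :: "real^'n^'n"
  using inner_matrix_vector[of x S y] by simp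

lemma matrix_norm_bound: "\<exists>K>0. \<forall>x. norm (M *v x) \<le> K * norm x" for M :: "real^'n^'m"
  using bounded_linear.pos_bounded[OF matrix_vector_mul_bounded_linear[of M]] by (simp add: mult.commute)

text \<open>Eigenvectors for distinct eigenvalues are orthogonal, hence independent.\<close>

lemma finite_eigenvalues:
  fixes S :: "real^'n^'n"
  assumes S: "transpose S = S"
  shows "finite (eigenvalues S)"
proof -
  define v where "v l = (SOME v. v \<noteq> 0 \<and> S *v v = l *\<^sub>R v)" for l
  have v: "v l \<noteq> 0" "S *v v l = l *\<^sub>R v l" if "l \<in> eigenvalues S" for l
    using that someI_ex[of "\<lambda>v. v \<noteq> 0 \<and> S *v v = l *\<^sub>R v"] by (auto simp: eigenvalues_def v_def)
  have orth: "v l \<bullet> v k = 0" if "l \<in> eigenvalues S" "k \<in> eigenvalues S" "l \<noteq> k" for l k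
  proof -
    have "(l - k) * (v l \<bullet> v k) = 0"
      using inner_symmetric[OF S, of "v l" "v k"] v[OF that(1)] v[OF that(2)] by (auto simp: left_diff_distrib)
    thus ?thesis using that(3) by simp
  qed
  have inj: "inj_on v (eigenvalues S)"
    by (rule inj_onI) (metis orth v(1) inner_eq_zero_iff)
  have "pairwise orthogonal (v ` eigenvalues S)"
    unfolding pairwise_def orthogonal_def using orth by (metis imageE)
  hence "independent (v ` eigenvalues S)"
    using v(1) by (intro pairwise_orthogonal_independent) auto
  hence "finite (v ` eigenvalues S)" using independent_bound by blast
  thus ?thesis using inj finite_imageD by blast
qed

text \<open>A minimiser \<open>v\<close> of the quadratic form on the compact unit sphere, with value \<open>l\<close>, minimises
  \<open>x \<bullet> S x - l \<parallel>x\<parallel>\<^sup>2\<close> over the whole space by homogeneity; its vanishing gradient says \<open>S v = l v\<close>.\<close>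

lemma rayleigh_minimum:
  fixes S :: "real^'n^'n"
  assumes S: "transpose S = S"
  shows "\<exists>l\<in>eigenvalues S. \<forall>x. l * (norm x)\<^sup>2 \<le> x \<bullet> (S *v x)"
proof -
  have cont: "continuous_on (sphere 0 1) (\<lambda>x. x \<bullet> (S *v x))"
    by (intro continuous_intros linear_continuous_on) auto
  obtain e :: "real^'n" where "norm e = 1" using vector_choose_size[of 1] by auto
  hence "sphere (0::real^'n) 1 \<noteq> {}" by force
  then obtain v where v: "norm v = 1" "\<And>x. norm x = 1 \<Longrightarrow> v \<bullet> (S *v v) \<le> x \<bullet> (S *v x)"
    using continuous_attains_inf[OF compact_sphere _ cont] by auto
  define l where "l = v \<bullet> (S *v v)"
  have low: "l * (norm x)\<^sup>2 \<le> x \<bullet> (S *v x)" for x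
  proof (cases "x = 0")
    case False
    have "l \<le> ((1 / norm x) *\<^sub>R x) \<bullet> (S *v ((1 / norm x) *\<^sub>R x))"
      unfolding l_def by (rule v(2)) (use False in simp)
    also have "\<dots> = (x \<bullet> (S *v x)) / (norm x)\<^sup>2"
      by (simp add: matrix_vector_mult_scaleR power2_eq_square)
    finally show ?thesis using False by (simp add: field_simps)
  qed auto
  obtain K where K: "K > 0" "\<And>x. norm (S *v x) \<le> K * norm x" using matrix_norm_bound[of S] by blast
  define \<phi> where "\<phi> x = x \<bullet> (S *v x) - l * (norm x)\<^sup>2" for x
  have "2 *\<^sub>R (S *v v - l *\<^sub>R v) = 0"
  proof (rule stationary_of_minimiser[where \<phi>=\<phi> and t=v and Q="K + \<bar>l\<bar>"])
    show "\<phi> v \<le> \<phi> u" for u using low[of u] v(1) by (simp add: \<phi>_def l_def)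
    show "\<phi> (v + h) \<le> \<phi> v + 2 *\<^sub>R (S *v v - l *\<^sub>R v) \<bullet> h + (K + \<bar>l\<bar>) * (norm h)\<^sup>2" for h
    proof -
      have "h \<bullet> (S *v h) \<le> norm h * (K * norm h)"
        by (rule order_trans[OF norm_cauchy_schwarz]) (intro mult_left_mono K, auto)
      hence 1: "h \<bullet> (S *v h) \<le> K * (norm h)\<^sup>2" by (simp add: power2_eq_square algebra_simps)
      have 2: "- l * (norm h)\<^sup>2 \<le> \<bar>l\<bar> * (norm h)\<^sup>2" by (intro mult_right_mono) auto
      have "\<phi> (v + h) = \<phi> v + 2 *\<^sub>R (S *v v - l *\<^sub>R v) \<bullet> h + (h \<bullet> (S *v h) - l * (norm h)\<^sup>2)"
        unfolding \<phi>_def power2_norm_eq_inner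
        using inner_symmetric[OF S, of v h]
        by (simp add: matrix_vector_right_distrib inner_add_left inner_add_right inner_diff_left
            inner_commute algebra_simps)
      thus ?thesis using 1 2 by (simp add: algebra_simps)
    qed
  qed
  hence "S *v v = l *\<^sub>R v" by simp
  hence "l \<in> eigenvalues S" using v(1) by (auto simp: eigenvalues_def intro!: exI[of _ v])
  thus ?thesis using low by blast
qed

lemma sigma_min_rayleigh:
  fixes S :: "real^'n^'n"
  assumes S: "transpose S = S"
  shows "sigma_min S \<in> eigenvalues S" "sigma_min S * (norm x)\<^sup>2 \<le> x \<bullet> (S *v x)"
proof -
  obtain l where l: "l \<in> eigenvalues S" "\<And>x. l * (norm x)\<^sup>2 \<le> x \<bullet> (S *v x)"
    using rayleigh_minimum[OF S] by blast
  have "l \<le> k" if k: "k \<in> eigenvalues S" for k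
  proof -
    obtain v where v: "v \<noteq> 0" "S *v v = k *\<^sub>R v" using k by (auto simp: eigenvalues_def)
    have "l * (norm v)\<^sup>2 \<le> k * (norm v)\<^sup>2"
      using l(2)[of v] v by (simp add: power2_norm_eq_inner)
    thus ?thesis using v(1) by simp
  qed
  hence "sigma_min S = l" unfolding sigma_min_def using l(1) finite_eigenvalues[OF S] by (intro Min_eqI) auto
  thus "sigma_min S \<in> eigenvalues S" "sigma_min S * (norm x)\<^sup>2 \<le> x \<bullet> (S *v x)" using l by auto
qed

lemma sigma_max_rayleigh:
  fixes S :: "real^'n^'n"
  assumes S: "transpose S = S"
  shows "sigma_max S \<in> eigenvalues S" "x \<bullet> (S *v x) \<le> sigma_max S * (norm x)\<^sup>2"
proof -
  have neg: "(- S) *v y = - (S *v y)" for y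
    using matrix_vector_mult_diff_rdistrib[of 0 S y] by simp
  have "transpose (- S) = - S" using S by (simp add: transpose_def vec_eq_iff)
  from rayleigh_minimum[OF this] obtain l
    where l: "l \<in> eigenvalues (- S)" "\<And>x. l * (norm x)\<^sup>2 \<le> - (x \<bullet> (S *v x))" by (auto simp: neg)
  have mem: "- l \<in> eigenvalues S"
    using l(1) by (auto simp: eigenvalues_def neg) (metis minus_equation_iff)
  have "k \<le> - l" if k: "k \<in> eigenvalues S" for k
  proof -
    obtain v where v: "v \<noteq> 0" "S *v v = k *\<^sub>R v" using k by (auto simp: eigenvalues_def)
    have "k * (norm v)\<^sup>2 \<le> (- l) * (norm v)\<^sup>2"
      using l(2)[of v] v by (simp add: power2_norm_eq_inner)
    thus ?thesis using v(1) by (metis mult_le_cancel_right_pos zero_less_norm_iff zero_less_power)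
  qed
  hence "sigma_max S = - l" unfolding sigma_max_def using mem finite_eigenvalues[OF S] by (intro Max_eqI) auto
  thus "sigma_max S \<in> eigenvalues S" "x \<bullet> (S *v x) \<le> sigma_max S * (norm x)\<^sup>2" using l(2)[of x] mem by auto
qed

lemma pos_def_sigma:
  fixes G :: "real^'n^'n"
  assumes G: "pos_def G"
  shows "0 < sigma_min G" "sigma_min G \<le> sigma_max G"
    "sigma_min G * (norm x)\<^sup>2 \<le> wnorm_sq G x" "0 \<le> wnorm_sq G x"
    "norm (G *v x) \<le> sigma_max G * norm x"
proof -
  have S: "transpose G = G" using G by (simp add: pos_def_def)
  have pd: "x \<noteq> 0 \<Longrightarrow> 0 < x \<bullet> (G *v x)" for x using G by (simp add: pos_def_def)
  have nn: "0 \<le> x \<bullet> (G *v x)" for x using pd[of x] by (cases "x = 0") auto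
  obtain v where v: "v \<noteq> 0" "G *v v = sigma_min G *\<^sub>R v"
    using sigma_min_rayleigh(1)[OF S] by (auto simp: eigenvalues_def)
  show min: "0 < sigma_min G"
    using pd[OF v(1)] v by (simp add: zero_less_mult_iff inner_gt_zero_iff not_less[symmetric] del: inner_gt_zero_iff) (meson inner_ge_zero not_less)
  show le: "sigma_min G \<le> sigma_max G"
    unfolding sigma_max_def using sigma_min_rayleigh(1)[OF S] finite_eigenvalues[OF S] by (intro Max_ge)
  show "sigma_min G * (norm x)\<^sup>2 \<le> wnorm_sq G x" unfolding wnorm_sq_def by (rule sigma_min_rayleigh(2)[OF S])
  show "0 \<le> wnorm_sq G x" using nn by (simp add: wnorm_sq_def)
  let ?s = "sigma_max G"
  define y where "y = G *v x"
  \<comment> \<open>Nonnegativity of the form \<open>G\<close> at \<open>s x - y\<close>, with \<open>s\<close> the largest eigenvalue, gives \<open>\<parallel>y\<parallel>\<^sup>2 \<le> s (x \<bullet> y)\<close>.\<close>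
  have s: "0 < ?s" using min le by simp
  have "0 \<le> (?s *\<^sub>R x - y) \<bullet> (G *v (?s *\<^sub>R x - y))" by (rule nn)
  also have "\<dots> = ?s * (?s * (x \<bullet> y)) - 2 * ?s * (y \<bullet> y) + y \<bullet> (G *v y)"
    using inner_symmetric[OF S, of x y]
    by (simp add: y_def[symmetric] matrix_vector_mult_diff_distrib matrix_vector_mult_scaleR
        inner_diff_left inner_diff_right inner_commute algebra_simps)
  also have "\<dots> \<le> ?s * (?s * (x \<bullet> y)) - 2 * ?s * (y \<bullet> y) + ?s * (y \<bullet> y)"
    using sigma_max_rayleigh(2)[OF S, of y] by (simp add: power2_norm_eq_inner)
  also have "\<dots> = ?s * (?s * (x \<bullet> y) - (norm y)\<^sup>2)" by (simp add: power2_norm_eq_inner algebra_simps)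
  finally have "(norm y)\<^sup>2 \<le> ?s * (x \<bullet> y)" using s by (simp add: zero_le_mult_iff)
  also have "\<dots> \<le> ?s * (norm x * norm y)" using s by (intro mult_left_mono norm_cauchy_schwarz) auto
  finally have "norm y * norm y \<le> (?s * norm x) * norm y" by (simp add: power2_eq_square algebra_simps)
  thus "norm (G *v x) \<le> ?s * norm x"
    using s by (cases "y = 0") (auto simp: y_def)
qed

text \<open>The third bound is the one that controls multipliers: it bounds \<open>A\<^sup>T\<close> from below, but only on the range of \<open>A\<close>,
  where \<open>\<parallel>A w\<parallel>\<^sup>2 = w \<bullet> A\<^sup>T A w \<le> \<parallel>w\<parallel> \<parallel>A\<^sup>T A w\<parallel>\<close> combines with \<open>\<sigma> \<parallel>w\<parallel> \<le> \<parallel>A\<^sup>T A w\<parallel>\<close>.\<close>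

lemma gram_sigma:
  fixes A :: "real^'d^'l"
  assumes A: "rank A = CARD('d)"
  defines "\<sigma> \<equiv> sigma_min (transpose A ** A)"
  shows "0 < \<sigma>" "\<sigma> * (norm w)\<^sup>2 \<le> (norm (A *v w))\<^sup>2"
    "\<sigma> * (norm (A *v w))\<^sup>2 \<le> (norm (transpose A *v (A *v w)))\<^sup>2"
proof -
  let ?S = "transpose A ** A"
  have S: "transpose ?S = ?S" by (simp add: matrix_transpose_mul)
  have q: "w \<bullet> (?S *v w) = (norm (A *v w))\<^sup>2" for w
    using inner_matrix_vector[of "A *v w" A w]
    by (simp add: power2_norm_eq_inner matrix_vector_mul_assoc[symmetric] inner_commute)
  obtain v where v: "v \<noteq> 0" "?S *v v = \<sigma> *\<^sub>R v"
    using sigma_min_rayleigh(1)[OF S] by (auto simp: eigenvalues_def \<sigma>_def)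
  have "inj ((*v) A)" using A by (simp add: full_rank_injective)
  hence "A *v v \<noteq> 0" using v(1) by (metis injD matrix_vector_mult_0_right)
  hence "0 < v \<bullet> (?S *v v)" by (simp add: q)
  thus pos: "0 < \<sigma>" using v by (simp add: zero_less_mult_iff inner_gt_zero_iff not_less[symmetric] del: inner_gt_zero_iff) (meson inner_ge_zero not_less)
  show lower: "\<sigma> * (norm w)\<^sup>2 \<le> (norm (A *v w))\<^sup>2"
    using sigma_min_rayleigh(2)[OF S, of w] by (simp add: q \<sigma>_def)
  let ?n = "norm (?S *v w)"
  have cs: "(norm (A *v w))\<^sup>2 \<le> norm w * ?n" unfolding q[symmetric] by (rule norm_cauchy_schwarz)
  have "(\<sigma> * norm w) * norm w \<le> ?n * norm w"
    using lower cs by (simp add: power2_eq_square algebra_simps)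
  hence w: "\<sigma> * norm w \<le> ?n" by (cases "w = 0") auto
  have "\<sigma> * (norm (A *v w))\<^sup>2 \<le> (\<sigma> * norm w) * ?n" using mult_left_mono[OF cs, of \<sigma>] pos by simp
  also have "\<dots> \<le> ?n * ?n" by (rule mult_right_mono[OF w]) simp
  finally show "\<sigma> * (norm (A *v w))\<^sup>2 \<le> (norm (transpose A *v (A *v w)))\<^sup>2"
    by (simp add: power2_eq_square matrix_vector_mul_assoc)
qed

section \<open>Gradients\<close>

lemma gradient_eqI: "GDERIV f x :> D \<Longrightarrow> gradient f x = D"
  unfolding gradient_def
proof (rule the_equality)
  fix D' assume "GDERIV f x :> D" "GDERIV f x :> D'"
  hence "(\<lambda>h. h \<bullet> D') = (\<lambda>h. h \<bullet> D)"
    unfolding gderiv_def by (rule has_derivative_unique[rotated])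
  thus "D' = D" by (metis vector_eq_ldot)
qed

lemma gderiv_gradient:
  fixes f :: "'a::euclidean_space \<Rightarrow> real"
  assumes "f differentiable (at x)"
  shows "GDERIV f x :> gradient f x"
proof -
  obtain f' where f': "(f has_derivative f') (at x)" using assms by (auto simp: differentiable_def)
  have "f' h = h \<bullet> adjoint f' 1" for h
    using adjoint_works[of f' h 1] has_derivative_linear[OF f'] by simp
  hence "GDERIV f x :> adjoint f' 1" using f' unfolding gderiv_def by (metis ext)
  thus ?thesis using gradient_eqI by metis
qed

text \<open>Restricted to the segment, \<open>f\<close> minus the quadratic model has nonpositive derivative.\<close>

lemma descent_inequality:
  fixes f :: "'a::euclidean_space \<Rightarrow> real"
  assumes "L_smooth L f"
  shows "f y \<le> f x + gradient f x \<bullet> (y - x) + L / 2 * (norm (y - x))\<^sup>2"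
proof -
  define h where "h = y - x"
  define \<psi> where "\<psi> t = f (x + t *\<^sub>R h) - t * (gradient f x \<bullet> h) - L / 2 * t\<^sup>2 * (norm h)\<^sup>2" for t
  have "\<psi> 1 \<le> \<psi> 0"
  proof (rule DERIV_nonpos_imp_nonincreasing[where f=\<psi>])
    fix t :: real assume t: "0 \<le> t" "t \<le> 1"
    let ?g = "gradient f (x + t *\<^sub>R h)"
    have "(f has_derivative (\<lambda>k. k \<bullet> ?g)) (at (x + t *\<^sub>R h))"
      using assms gderiv_gradient unfolding L_smooth_def gderiv_def by blast
    moreover have "((\<lambda>t. x + t *\<^sub>R h) has_derivative (\<lambda>s. s *\<^sub>R h)) (at t)"
      by (auto intro!: derivative_eq_intros)
    ultimately have "((\<lambda>t. f (x + t *\<^sub>R h)) has_derivative (\<lambda>s. (s *\<^sub>R h) \<bullet> ?g)) (at t)"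
      using diff_chain_at[of "\<lambda>t. x + t *\<^sub>R h" "\<lambda>s. s *\<^sub>R h" t f "\<lambda>k. k \<bullet> ?g"] by (simp add: o_def)
    hence "((\<lambda>t. f (x + t *\<^sub>R h)) has_real_derivative (h \<bullet> ?g)) (at t)"
      unfolding has_field_derivative_def by (rule has_derivative_eq_rhs) (auto simp: mult.commute)
    hence "(\<psi> has_real_derivative (h \<bullet> ?g - gradient f x \<bullet> h - L / 2 * (2 * t) * (norm h)\<^sup>2)) (at t)"
      unfolding \<psi>_def by (auto intro!: derivative_eq_intros)
    moreover have "h \<bullet> ?g - gradient f x \<bullet> h - L / 2 * (2 * t) * (norm h)\<^sup>2 \<le> 0"
    proof -
      have "h \<bullet> ?g - gradient f x \<bullet> h = h \<bullet> (?g - gradient f x)"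
        by (simp add: inner_diff_right inner_commute)
      also have "\<dots> \<le> norm h * (L * norm (t *\<^sub>R h))"
      proof (intro order_trans[OF norm_cauchy_schwarz] mult_left_mono)
        show "norm (?g - gradient f x) \<le> L * norm (t *\<^sub>R h)"
          using assms unfolding L_smooth_def by (metis add_diff_cancel_left')
      qed simp
      finally show ?thesis using t by (simp add: power2_eq_square algebra_simps)
    qed
    ultimately show "\<exists>D. (\<psi> has_real_derivative D) (at t) \<and> D \<le> 0" by blast
  qed simp
  thus ?thesis by (simp add: \<psi>_def h_def)
qed

lemma gradient_favg:
  assumes "\<forall>i\<in>{1..n}. L_smooth L (fi i)"
  shows "GDERIV (favg n fi) x :> (1 / real n) *\<^sub>R (\<Sum>i=1..n. gradient (fi i) x)"
proof -
  have "(fi i has_derivative (\<lambda>h. h \<bullet> gradient (fi i) x)) (at x)" if "i \<in> {1..n}" for i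
    using assms that gderiv_gradient unfolding L_smooth_def gderiv_def by blast
  hence "((\<lambda>x. \<Sum>i=1..n. fi i x) has_derivative (\<lambda>h. \<Sum>i=1..n. h \<bullet> gradient (fi i) x)) (at x)"
    by (intro has_derivative_sum) auto
  from has_derivative_mult_right[OF this, of "1 / real n"]
  show ?thesis unfolding gderiv_def favg_def[abs_def] by (simp add: inner_sum_right)
qed

lemma L_smooth_favg:
  assumes fi: "\<forall>i\<in>{1..n}. L_smooth L (fi i)" and n: "1 \<le> n"
  shows "L_smooth L (favg n fi)"
  unfolding L_smooth_def
proof (intro conjI allI)
  fix x y
  show "favg n fi differentiable at x"
    using gradient_favg[OF fi] unfolding gderiv_def differentiable_def by blast
  have "norm (gradient (favg n fi) x - gradient (favg n fi) y)
      = (1 / real n) * norm (\<Sum>i=1..n. gradient (fi i) x - gradient (fi i) y)"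
    by (simp add: gradient_eqI[OF gradient_favg[OF fi]] sum_subtractf real_vector.scale_right_diff_distrib[symmetric])
  also have "\<dots> \<le> (1 / real n) * (\<Sum>i=1..n. L * norm (x - y))"
    using fi by (intro mult_left_mono order_trans[OF norm_sum] sum_mono) (auto simp: L_smooth_def)
  also have "\<dots> = L * norm (x - y)" using n by simp
  finally show "norm (gradient (favg n fi) x - gradient (favg n fi) y) \<le> L * norm (x - y)" .
qed

section \<open>One iteration of SPIDER-ADMM\<close>

lemma residual_upd:
  assumes "j \<in> {1..m}"
  shows "residual m A B c x (y(j := t)) = residual m A B c x y + B j *v (t - y j)"
proof -
  have "(\<Sum>i=1..m. B i *v (y(j := t)) i) = B j *v t + (\<Sum>i\<in>{1..m}-{j}. B i *v (y(j := t)) i)"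
    using assms by (subst sum.remove[of _ j]) auto
  also have "(\<Sum>i\<in>{1..m}-{j}. B i *v (y(j := t)) i) = (\<Sum>i\<in>{1..m}-{j}. B i *v y i)"
    by (intro sum.cong) auto
  also have "\<dots> = (\<Sum>i=1..m. B i *v y i) - B j *v y j"
    using assms by (subst (2) sum.remove[of _ j]) auto
  finally show ?thesis by (simp add: residual_def algebra_simps)
qed

lemma residual_diff_x: "residual m A B c x' y = residual m A B c x y + A *v (x' - x)"
  by (simp add: residual_def algebra_simps)

lemma residual_diff_y:
  "residual m A B c x y' = residual m A B c x y + (\<Sum>j=1..m. B j *v (y' j - y j))"
  by (simp add: residual_def sum_subtractf matrix_vector_mult_diff_distrib)

lemma sum_upd:
  fixes g :: "nat \<Rightarrow> 'a \<Rightarrow> real"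
  assumes "j \<in> {1..m}"
  shows "(\<Sum>i=1..m. g i ((y(j := t)) i)) = g j t + (\<Sum>i\<in>{1..m}-{j}. g i (y i))"
proof -
  have "(\<Sum>i=1..m. g i ((y(j := t)) i)) = g j t + (\<Sum>i\<in>{1..m}-{j}. g i ((y(j := t)) i))"
    using assms by (subst sum.remove[of _ j]) auto
  also have "(\<Sum>i\<in>{1..m}-{j}. g i ((y(j := t)) i)) = (\<Sum>i\<in>{1..m}-{j}. g i (y i))"
    by (intro sum.cong) auto
  finally show ?thesis .
qed

lemma wnorm_sq_add:
  assumes "transpose S = S"
  shows "wnorm_sq S (x + h) = wnorm_sq S x + 2 * ((S *v x) \<bullet> h) + wnorm_sq S h"
  using inner_symmetric[OF assms, of x h]
  by (simp add: wnorm_sq_def matrix_vector_right_distrib inner_add_left inner_add_right inner_commute)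

lemma power2_norm_add: "(norm (a + b))\<^sup>2 = (norm a)\<^sup>2 + 2 * (a \<bullet> b) + (norm b)\<^sup>2" for a :: "'a::real_inner"
  by (simp add: power2_norm_eq_inner inner_add_left inner_add_right inner_commute)

text \<open>Completing the square. This bound makes the subproblems coercive and keeps the augmented Lagrangian
  bounded below.\<close>

lemma multiplier_term_ge:
  fixes z r :: "'a::real_inner" and \<rho> :: real
  assumes "0 < \<rho>"
  shows "- (norm z)\<^sup>2 / (2 * \<rho>) \<le> - (z \<bullet> r) + \<rho> / 2 * (norm r)\<^sup>2"
proof -
  have "0 \<le> (norm (\<rho> *\<^sub>R r - z))\<^sup>2 / (2 * \<rho>)" using assms by simp
  also have "(norm (\<rho> *\<^sub>R r - z))\<^sup>2 = \<rho>\<^sup>2 * (norm r)\<^sup>2 - 2 * \<rho> * (z \<bullet> r) + (norm z)\<^sup>2"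
    unfolding power2_norm_eq_inner
    by (simp add: inner_diff_left inner_diff_right inner_commute power2_eq_square algebra_simps)
  also have "(\<rho>\<^sup>2 * (norm r)\<^sup>2 - 2 * \<rho> * (z \<bullet> r) + (norm z)\<^sup>2) / (2 * \<rho>)
      = - (z \<bullet> r) + \<rho> / 2 * (norm r)\<^sup>2 + (norm z)\<^sup>2 / (2 * \<rho>)"
    using assms by (simp add: field_simps power2_eq_square)
  finally show ?thesis by simp
qed

lemma quadratic_penalty_expand:
  fixes M :: "real^'a^'b" and r z :: "real^'b"
  assumes K: "\<And>x. norm (M *v x) \<le> K * norm x" and \<rho>: "0 < \<rho>"
  shows "- (z \<bullet> (r + M *v h)) + \<rho> / 2 * (norm (r + M *v h))\<^sup>2
    \<le> - (z \<bullet> r) + \<rho> / 2 * (norm r)\<^sup>2 + (\<rho> *\<^sub>R (transpose M *v r) - transpose M *v z) \<bullet> h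
       + \<rho> / 2 * K\<^sup>2 * (norm h)\<^sup>2"
proof -
  have "(norm (M *v h))\<^sup>2 \<le> (K * norm h)\<^sup>2" by (intro power_mono K) auto
  hence "\<rho> / 2 * (norm (M *v h))\<^sup>2 \<le> \<rho> / 2 * (K\<^sup>2 * (norm h)\<^sup>2)"
    using \<rho> by (intro mult_left_mono) (auto simp: power_mult_distrib)
  moreover have "z \<bullet> (M *v h) = (transpose M *v z) \<bullet> h" "r \<bullet> (M *v h) = (transpose M *v r) \<bullet> h"
    by (rule inner_matrix_vector)+
  ultimately show ?thesis
    by (simp add: power2_norm_add inner_add_right inner_diff_left algebra_simps)
qed

text \<open>What the choice of \<open>\<eta>\<close> and \<open>\<rho>\<close> buys, with \<open>T = \<kappa>\<^sub>G L / \<alpha>\<close>: the metric \<open>G / \<eta>\<close> dominates the curvature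
  \<open>L\<close>, has norm at most \<open>3 T / 2\<close>, and \<open>\<rho> \<sigma> \<ge> 13 T\<close> because \<open>13\<^sup>2 \<le> 170\<close>. The constants \<open>\<Gamma>\<close>, \<open>\<mu>\<close> bound the
  remaining matrices, \<open>Cw\<close> converts squared moves into squared subgradient residuals of the \<open>y\<close>-blocks, and \<open>\<zeta>\<close> is
  the fraction of the squared stationarity measure that the descent of one iteration can pay for. Their constraints
  mention neither the functions \<open>f\<^sub>i\<close>, \<open>g\<^sub>j\<close> nor \<open>n\<close>, \<open>q\<close>, which is what makes the final constants uniform.\<close>

locale spider_admm =
  fixes A :: "real^'d::finite^'l::finite" and B :: "nat \<Rightarrow> real^'p::finite^'l" and c :: "real^'l"
    and G :: "real^'d^'d" and H :: "nat \<Rightarrow> real^'p^'p" and m :: nat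
    and L \<delta> \<eta> \<rho> \<sigma> T \<Gamma> \<mu> \<zeta> Cw :: real
    and n q :: nat and fi :: "nat \<Rightarrow> real^'d \<Rightarrow> real" and g :: "nat \<Rightarrow> real^'p \<Rightarrow> real"
  assumes L_pos: "0 < L" and L_le_T: "L \<le> T"
    and sigma_pos: "0 < \<sigma>"
    and A_lower: "\<And>w. \<sigma> * (norm w)\<^sup>2 \<le> (norm (A *v w))\<^sup>2"
    and At_lower: "\<And>w. \<sigma> * (norm (A *v w))\<^sup>2 \<le> (norm (transpose A *v (A *v w)))\<^sup>2"
    and A_range: "\<And>y. \<exists>x. residual m A B c x y = 0"
    and eta_pos: "0 < \<eta>" and G: "pos_def G"
    and G_lower: "\<And>x. L * (norm x)\<^sup>2 \<le> (1 / \<eta>) * wnorm_sq G x"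
    and G_upper: "\<And>x. norm ((1 / \<eta>) *\<^sub>R (G *v x)) \<le> 3 / 2 * T * norm x"
    and H: "\<And>j. j \<in> {1..m} \<Longrightarrow> pos_def (H j)"
    and rho_pos: "0 < \<rho>" and rho_sigma: "13 * T \<le> \<rho> * \<sigma>"
    and Gamma_nonneg: "0 \<le> \<Gamma>"
    and A_upper: "\<And>x. norm (A *v x) \<le> \<Gamma> * norm x"
    and B_upper: "\<And>j x. j \<in> {1..m} \<Longrightarrow> norm (B j *v x) \<le> \<Gamma> * norm x"
    and Bt_upper: "\<And>j x. j \<in> {1..m} \<Longrightarrow> norm (transpose (B j) *v x) \<le> \<Gamma> * norm x"
    and H_upper: "\<And>j x. j \<in> {1..m} \<Longrightarrow> norm (H j *v x) \<le> \<Gamma> * norm x"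
    and mu_pos: "0 < \<mu>"
    and H_lower: "\<And>j x. j \<in> {1..m} \<Longrightarrow> \<mu> * (norm x)\<^sup>2 \<le> wnorm_sq (H j) x"
    and Cw: "Cw = real m * (\<rho> * \<Gamma>\<^sup>2 + \<Gamma>)\<^sup>2 * (real m + 1) * (1 + 1 / \<mu>)"
    and zeta_pos: "0 < \<zeta>" and zeta_Cw: "\<zeta> * Cw \<le> 1 / 2" and zeta_rho: "\<zeta> \<le> \<rho> / 10"
    and zeta_T: "\<zeta> * (3 * (L\<^sup>2 + (3 / 2 * T)\<^sup>2) + Cw) \<le> T / 2" and zeta_T': "3 * \<zeta> \<le> 1 / (10 * T)"
    and n: "1 \<le> n" and q: "1 \<le> q"
    and standing: "standing_assumptions L \<delta> n fi m g"
begin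

abbreviation "F \<equiv> favg n fi"
abbreviation "res \<equiv> residual m A B c"
abbreviation "AL \<equiv> aug_lagrangian \<rho> F g m A B c"
abbreviation "sweep \<equiv> y_sweep \<rho> F g m A B c H"
abbreviation "sdist \<equiv> dist_stationary F g m A B c"
abbreviation "lower_value \<equiv> (INF x. F x) + (\<Sum>j=1..m. INF t. g j t)"

lemma T_pos: "0 < T" using L_pos L_le_T by simp

lemma F_smooth: "L_smooth L F"
  using standing n by (intro L_smooth_favg) (auto simp: standing_assumptions_def)

lemma F_gradient_lipschitz: "norm (gradient F x - gradient F y) \<le> L * norm (x - y)"
  using F_smooth by (simp add: L_smooth_def)

lemma g_convex: "j \<in> {1..m} \<Longrightarrow> convex_on UNIV (g j)"
  and g_bdd: "j \<in> {1..m} \<Longrightarrow> bdd_below (range (g j))"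
  and F_bdd: "bdd_below (range F)"
  and F_gradient_bound: "(norm (gradient F x))\<^sup>2 \<le> \<delta>\<^sup>2"
  using standing by (auto simp: standing_assumptions_def)

lemma res_in_range: "\<exists>w. res x y = A *v w"
proof -
  obtain x1 where "res x1 y = 0" using A_range by blast
  hence "res x y = A *v (x - x1)" using residual_diff_x[of m A B c x y x1] by simp
  thus ?thesis by blast
qed

lemma AL_upd:
  assumes "j \<in> {1..m}"
  shows "AL x (y(j := t)) z = g j t + (F x + (\<Sum>i\<in>{1..m}-{j}. g i (y i))
      - z \<bullet> (res x y + B j *v (t - y j)) + \<rho> / 2 * (norm (res x y + B j *v (t - y j)))\<^sup>2)"
  unfolding aug_lagrangian_def lagrangian_def residual_upd[OF assms] sum_upd[OF assms] by simp

subsection \<open>The block updates\<close>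

text \<open>\<open>g\<^sub>j\<close> is bounded below and finite convex, hence continuous; the multiplier and penalty terms are bounded below
  together; the proximal term supplies the quadratic growth.\<close>

lemma y_subproblem_solvable:
  assumes j: "j \<in> {1..m}"
  shows "\<exists>t. \<forall>u. AL x (Y(j := t)) z + 1 / 2 * wnorm_sq (H j) (t - a)
     \<le> AL x (Y(j := u)) z + 1 / 2 * wnorm_sq (H j) (u - a)"
proof (rule coercive_attains_min)
  have "continuous_on UNIV (g j)" using convex_on_continuous[OF open_UNIV g_convex[OF j]] .
  thus "continuous_on UNIV (\<lambda>t. AL x (Y(j := t)) z + 1 / 2 * wnorm_sq (H j) (t - a))"
    unfolding AL_upd[OF j] wnorm_sq_def
    by (intro continuous_intros continuous_on_compose2[OF linear_continuous_on[OF matrix_vector_mul_bounded_linear], where t=UNIV]) auto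
  show "0 < \<mu> / 2" using mu_pos by simp
  fix t
  have "(INF t. g j t) \<le> g j t" by (rule cINF_lower[OF g_bdd[OF j]]) simp
  moreover have "\<mu> / 2 * (norm (t - a))\<^sup>2 \<le> 1 / 2 * wnorm_sq (H j) (t - a)" using H_lower[OF j, of "t - a"] by simp
  ultimately show "((INF t. g j t) + (F x + (\<Sum>i\<in>{1..m}-{j}. g i (Y i))) - (norm z)\<^sup>2 / (2 * \<rho>))
       + \<mu> / 2 * (norm (t - a))\<^sup>2 - 0 * norm (t - a)
     \<le> AL x (Y(j := t)) z + 1 / 2 * wnorm_sq (H j) (t - a)"
    unfolding AL_upd[OF j] using multiplier_term_ge[OF rho_pos, of z "res x Y + B j *v (t - Y j)"] by simp
qed

lemma y_subproblem_optimality: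
  assumes j: "j \<in> {1..m}"
    and min: "\<And>u. AL x (Y(j := t)) z + 1 / 2 * wnorm_sq (H j) (t - a)
     \<le> AL x (Y(j := u)) z + 1 / 2 * wnorm_sq (H j) (u - a)"
  shows "transpose (B j) *v z - \<rho> *\<^sub>R (transpose (B j) *v res x (Y(j := t))) - H j *v (t - a)
     \<in> subdifferential (g j) t"
proof -
  let ?r = "\<lambda>t. res x Y + B j *v (t - Y j)"
  define \<phi> where "\<phi> t = F x + (\<Sum>i\<in>{1..m}-{j}. g i (Y i)) - z \<bullet> ?r t + \<rho> / 2 * (norm (?r t))\<^sup>2
       + 1 / 2 * wnorm_sq (H j) (t - a)" for t
  define D where "D = \<rho> *\<^sub>R (transpose (B j) *v ?r t) - transpose (B j) *v z + H j *v (t - a)"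
  have "- D \<in> subdifferential (g j) t"
  proof (rule subgradient_of_minimiser[OF g_convex[OF j], where \<phi>=\<phi> and Q="\<rho> / 2 * \<Gamma>\<^sup>2 + \<Gamma> / 2"])
    show "g j t + \<phi> t \<le> g j u + \<phi> u" for u
      using min[of u] unfolding AL_upd[OF j] by (simp add: \<phi>_def algebra_simps)
    show "\<phi> (t + h) \<le> \<phi> t + D \<bullet> h + (\<rho> / 2 * \<Gamma>\<^sup>2 + \<Gamma> / 2) * (norm h)\<^sup>2" for h
    proof -
      have r: "?r (t + h) = ?r t + B j *v h" by (simp add: algebra_simps matrix_vector_right_distrib)
      have S: "transpose (H j) = H j" using H[OF j] by (simp add: pos_def_def)
      have w: "wnorm_sq (H j) (t + h - a) = wnorm_sq (H j) (t - a) + 2 * ((H j *v (t - a)) \<bullet> h) + wnorm_sq (H j) h"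
        using wnorm_sq_add[OF S, of "t - a" h] by (simp add: algebra_simps)
      have "wnorm_sq (H j) h \<le> norm h * (\<Gamma> * norm h)"
        unfolding wnorm_sq_def by (intro order_trans[OF norm_cauchy_schwarz] mult_left_mono H_upper[OF j]) auto
      hence "1 / 2 * wnorm_sq (H j) h \<le> \<Gamma> / 2 * (norm h)\<^sup>2" by (simp add: power2_eq_square algebra_simps)
      thus ?thesis
        using quadratic_penalty_expand[OF B_upper[OF j] rho_pos, of z "?r t" h]
        unfolding \<phi>_def r w D_def by (simp add: inner_add_left algebra_simps)
    qed
  qed
  moreover have "- D = transpose (B j) *v z - \<rho> *\<^sub>R (transpose (B j) *v res x (Y(j := t))) - H j *v (t - a)"
    unfolding D_def residual_upd[OF j] by simp
  ultimately show ?thesis by simp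
qed

lemma sweep_Suc:
  assumes "Suc j \<in> {1..m}"
  shows "AL x ((sweep x z y j)(Suc j := sweep x z y (Suc j) (Suc j))) z
       + 1 / 2 * wnorm_sq (H (Suc j)) (sweep x z y (Suc j) (Suc j) - y (Suc j))
    \<le> AL x ((sweep x z y j)(Suc j := u)) z + 1 / 2 * wnorm_sq (H (Suc j)) (u - y (Suc j))"
  using arg_min_le[OF y_subproblem_solvable[OF assms], of x "sweep x z y j" z "y (Suc j)" u]
  by (simp add: Let_def)

lemma sweep_upd: "sweep x z y (Suc j) = (sweep x z y j)(Suc j := sweep x z y (Suc j) (Suc j))"
  by (simp add: Let_def)

lemma sweep_untouched: "k < i \<Longrightarrow> sweep x z y k i = y i"
  by (induction k) (auto simp: Let_def)

lemma sweep_final: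
  assumes "k \<le> l" "i \<le> k" shows "sweep x z y l i = sweep x z y k i"
  using assms by (induction l rule: dec_induct) (auto simp: Let_def)

text \<open>Each block can keep its old value, at which the proximal term vanishes, so its update lowers the augmented
  Lagrangian by at least the proximal term at the new value.\<close>

lemma sweep_descent:
  assumes "k \<le> m"
  shows "AL x (sweep x z y k) z + 1 / 2 * (\<Sum>j=1..k. wnorm_sq (H j) (sweep x z y k j - y j)) \<le> AL x y z"
  using assms
proof (induction k)
  case (Suc k)
  let ?Y = "sweep x z y (Suc k)"
  have "(\<Sum>j=1..k. wnorm_sq (H j) (?Y j - y j)) = (\<Sum>j=1..k. wnorm_sq (H j) (sweep x z y k j - y j))"
    by (intro sum.cong refl) (simp add: Let_def)
  moreover have "AL x ?Y z + 1 / 2 * wnorm_sq (H (Suc k)) (?Y (Suc k) - y (Suc k)) \<le> AL x (sweep x z y k) z"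
  proof -
    have "(sweep x z y k)(Suc k := y (Suc k)) = sweep x z y k" using sweep_untouched[of k "Suc k"] by auto
    thus ?thesis
      using sweep_Suc[of k x z y "y (Suc k)"] Suc.prems sweep_upd[of x z y k]
      by (simp add: wnorm_sq_def del: y_sweep.simps)
  qed
  ultimately show ?case using Suc by (simp add: add_divide_distrib del: y_sweep.simps)
qed simp

lemma sweep_subgradient:
  assumes j: "j \<in> {1..m}"
  shows "transpose (B j) *v z - \<rho> *\<^sub>R (transpose (B j) *v res x (sweep x z y j)) - H j *v (sweep x z y m j - y j)
     \<in> subdifferential (g j) (sweep x z y m j)"
proof -
  obtain i where i: "j = Suc i" using j by (cases j) auto
  have "sweep x z y m j = sweep x z y j j" using j by (intro sweep_final) auto
  thus ?thesis
    using y_subproblem_optimality[OF j, of x "sweep x z y i" "sweep x z y j j" z "y j"] sweep_Suc[of i x z y] j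
      sweep_upd[of x z y i]
    unfolding i by (simp del: y_sweep.simps)
qed

text \<open>The right-hand side is \<open>A\<^sup>T\<close> applied to the next multiplier: after every iteration \<open>A\<^sup>T z\<close> is determined by the
  gradient estimate and the last move, which is how multiplier increments are controlled.\<close>

lemma x_update_optimality:
  fixes v xk z y
  defines "x' \<equiv> x_update m A B c \<eta> \<rho> G v xk y z"
  shows "v + (1 / \<eta>) *\<^sub>R (G *v (x' - xk)) = transpose A *v (z - \<rho> *\<^sub>R res x' y)"
proof -
  define \<phi> where "\<phi> x = v \<bullet> (x - xk) + 1 / (2 * \<eta>) * wnorm_sq G (x - xk) - z \<bullet> res x y
     + \<rho> / 2 * (norm (res x y))\<^sup>2" for x
  have S: "transpose G = G" using G by (simp add: pos_def_def)
  have ex: "\<exists>t. \<forall>u. \<phi> t \<le> \<phi> u"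
  proof (rule coercive_attains_min)
    show "continuous_on UNIV \<phi>"
      unfolding \<phi>_def[abs_def] wnorm_sq_def residual_def
      by (intro continuous_intros continuous_on_compose2[OF linear_continuous_on[OF matrix_vector_mul_bounded_linear], where t=UNIV]) auto
    show "0 < L / 2" using L_pos by simp
    fix x
    have "L / 2 * (norm (x - xk))\<^sup>2 \<le> 1 / (2 * \<eta>) * wnorm_sq G (x - xk)" using G_lower[of "x - xk"] by simp
    moreover have "- (norm v * norm (x - xk)) \<le> v \<bullet> (x - xk)"
      using Cauchy_Schwarz_ineq2[of v "x - xk"] by linarith
    ultimately show "- (norm z)\<^sup>2 / (2 * \<rho>) + L / 2 * (norm (x - xk))\<^sup>2 - norm v * norm (x - xk) \<le> \<phi> x"
      unfolding \<phi>_def using multiplier_term_ge[OF rho_pos, of z "res x y"] by linarith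
  qed
  have x': "x' = (ARG_MIN \<phi> x. True)" unfolding x'_def x_update_def \<phi>_def[abs_def] ..
  have "v + (1 / \<eta>) *\<^sub>R (G *v (x' - xk)) + (\<rho> *\<^sub>R (transpose A *v res x' y) - transpose A *v z) = 0"
    (is "?D = 0")
  proof (rule stationary_of_minimiser[where \<phi>=\<phi> and t=x' and Q="\<rho> / 2 * \<Gamma>\<^sup>2 + 3 / 4 * T"])
    show "\<phi> x' \<le> \<phi> u" for u unfolding x' by (rule arg_min_le[OF ex])
    show "\<phi> (x' + h) \<le> \<phi> x' + ?D \<bullet> h + (\<rho> / 2 * \<Gamma>\<^sup>2 + 3 / 4 * T) * (norm h)\<^sup>2" for h
    proof -
      have r: "res (x' + h) y = res x' y + A *v h" using residual_diff_x[of m A B c "x' + h" y x'] by simp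
      have w: "wnorm_sq G (x' + h - xk) = wnorm_sq G (x' - xk) + 2 * ((G *v (x' - xk)) \<bullet> h) + wnorm_sq G h"
        using wnorm_sq_add[OF S, of "x' - xk" h] by (simp add: algebra_simps)
      have "(1 / \<eta>) * wnorm_sq G h = h \<bullet> ((1 / \<eta>) *\<^sub>R (G *v h))" by (simp add: wnorm_sq_def)
      also have "\<dots> \<le> norm h * (3 / 2 * T * norm h)"
        by (intro order_trans[OF norm_cauchy_schwarz] mult_left_mono G_upper) auto
      finally have "1 / (2 * \<eta>) * wnorm_sq G h \<le> 3 / 4 * T * (norm h)\<^sup>2"
        by (simp add: power2_eq_square algebra_simps)
      moreover have "1 / (2 * \<eta>) * (wnorm_sq G (x' - xk) + 2 * ((G *v (x' - xk)) \<bullet> h) + wnorm_sq G h)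
         = 1 / (2 * \<eta>) * wnorm_sq G (x' - xk) + (1 / \<eta>) * ((G *v (x' - xk)) \<bullet> h) + 1 / (2 * \<eta>) * wnorm_sq G h"
        using eta_pos by (simp add: field_simps)
      moreover have "v \<bullet> (x' + h - xk) = v \<bullet> (x' - xk) + v \<bullet> h"
        by (simp add: inner_add_right inner_diff_right)
      ultimately show ?thesis
        using quadratic_penalty_expand[OF A_upper rho_pos, of z "res x' y" h]
        unfolding \<phi>_def r w by (simp add: inner_add_left distrib_right)
    qed
  qed
  thus ?thesis by (simp add: algebra_simps matrix_vector_mult_scaleR add_eq_0_iff)
qed

end

lemma five_term_square_le:
  fixes a b c d e :: real
  shows "(a + b + c + d + e)\<^sup>2 \<le> 5 * (a\<^sup>2 + b\<^sup>2 + c\<^sup>2 + d\<^sup>2 + e\<^sup>2)"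
proof -
  have "0 \<le> (a-b)\<^sup>2 + (a-c)\<^sup>2 + (a-d)\<^sup>2 + (a-e)\<^sup>2 + (b-c)\<^sup>2 + (b-d)\<^sup>2 + (b-e)\<^sup>2 + (c-d)\<^sup>2 + (c-e)\<^sup>2 + (d-e)\<^sup>2"
    by simp
  thus ?thesis by (simp add: power2_eq_square algebra_simps)
qed

context spider_admm
begin

text \<open>Testing the optimality condition with the move \<open>d\<close> replaces the multiplier and penalty terms by
  \<open>- v \<bullet> d - d \<bullet> G d / \<eta> - \<rho> / 2 \<parallel>A d\<parallel>\<^sup>2\<close>. The metric term absorbs the two contributions \<open>L / 2 \<parallel>d\<parallel>\<^sup>2\<close> from
  smoothness and from the estimation error, leaving the penalty term as net descent.\<close>

lemma x_update_descent:
  fixes v x z y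
  defines "x' \<equiv> x_update m A B c \<eta> \<rho> G v x y z"
  shows "AL x' y z \<le> AL x y z + (norm (v - gradient F x))\<^sup>2 / (2 * L) - \<rho> * \<sigma> / 2 * (norm (x' - x))\<^sup>2"
proof -
  define d where "d = x' - x"
  define r where "r = res x' y"
  have res: "res x y = r - A *v d"
    using residual_diff_x[of m A B c x y x'] by (simp add: r_def d_def algebra_simps)
  have opt: "v + (1 / \<eta>) *\<^sub>R (G *v d) = transpose A *v (z - \<rho> *\<^sub>R r)"
    unfolding d_def r_def x'_def by (rule x_update_optimality)
  have "(z - \<rho> *\<^sub>R r) \<bullet> (A *v d) = (v + (1 / \<eta>) *\<^sub>R (G *v d)) \<bullet> d"
    unfolding opt by (rule inner_matrix_vector)
  hence zA: "z \<bullet> (A *v d) - \<rho> * (r \<bullet> (A *v d)) = v \<bullet> d + (1 / \<eta>) * wnorm_sq G d"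
    by (simp add: inner_diff_left inner_add_left wnorm_sq_def inner_commute[of "G *v d"])
  have n2: "(norm (r - A *v d))\<^sup>2 = (norm r)\<^sup>2 - 2 * (r \<bullet> (A *v d)) + (norm (A *v d))\<^sup>2"
    using power2_norm_add[of r "- (A *v d)"] by simp
  have eq: "AL x' y z - AL x y z = F x' - F x - (v \<bullet> d + (1 / \<eta>) * wnorm_sq G d) - \<rho> / 2 * (norm (A *v d))\<^sup>2"
    unfolding aug_lagrangian_def lagrangian_def res r_def[symmetric] n2 zA[symmetric]
    by (simp add: algebra_simps)
  have "F x' \<le> F x + gradient F x \<bullet> d + L / 2 * (norm d)\<^sup>2"
    unfolding d_def by (rule descent_inequality[OF F_smooth])
  moreover have "L * (norm d)\<^sup>2 \<le> (1 / \<eta>) * wnorm_sq G d" by (rule G_lower)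
  moreover have "\<rho> / 2 * (\<sigma> * (norm d)\<^sup>2) \<le> \<rho> / 2 * (norm (A *v d))\<^sup>2"
    using rho_pos by (intro mult_left_mono A_lower) auto
  moreover have "(gradient F x - v) \<bullet> d \<le> (norm (v - gradient F x))\<^sup>2 / (2 * L) + L / 2 * (norm d)\<^sup>2"
  proof -
    let ?e = "norm (v - gradient F x)" and ?d = "norm d"
    have "(gradient F x - v) \<bullet> d \<le> ?e * ?d"
      using norm_cauchy_schwarz[of "gradient F x - v" d] by (simp add: norm_minus_commute)
    moreover have "0 \<le> (?e - L * ?d)\<^sup>2 / (2 * L)" using L_pos by simp
    moreover have "(?e - L * ?d)\<^sup>2 / (2 * L) = ?e\<^sup>2 / (2 * L) + L / 2 * ?d\<^sup>2 - ?e * ?d"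
      using L_pos by (simp add: field_simps power2_eq_square)
    ultimately show ?thesis by linarith
  qed
  ultimately show ?thesis using eq unfolding d_def[symmetric] by (simp add: inner_diff_left algebra_simps)
qed

text \<open>The multiplier step raises the augmented Lagrangian; its increment lies in the range of \<open>A\<close>, where \<open>A\<^sup>T\<close> is
  bounded below.\<close>

lemma multiplier_update:
  assumes "z' = z - \<rho> *\<^sub>R res x y"
  shows "AL x y z' = AL x y z + (norm (z' - z))\<^sup>2 / \<rho>"
    "\<sigma> * (norm (z' - z))\<^sup>2 \<le> (norm (transpose A *v z' - transpose A *v z))\<^sup>2"
    "(norm (res x y))\<^sup>2 = (norm (z' - z))\<^sup>2 / \<rho>\<^sup>2"
proof -
  have n: "norm (z' - z) = \<rho> * norm (res x y)" using assms rho_pos by simp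
  show "AL x y z' = AL x y z + (norm (z' - z))\<^sup>2 / \<rho>"
    unfolding n using rho_pos
    by (simp add: aug_lagrangian_def lagrangian_def assms inner_diff_left power2_norm_eq_inner
        power_mult_distrib power2_eq_square[of \<rho>])
  show "(norm (res x y))\<^sup>2 = (norm (z' - z))\<^sup>2 / \<rho>\<^sup>2"
    unfolding n using rho_pos by (simp add: power_mult_distrib)
  obtain w where w: "res x y = A *v w" using res_in_range by blast
  have "z' - z = A *v (- \<rho> *\<^sub>R w)" using matrix_vector_mult_scaleR[of A "- \<rho>" w] by (simp add: assms w)
  thus "\<sigma> * (norm (z' - z))\<^sup>2 \<le> (norm (transpose A *v z' - transpose A *v z))\<^sup>2"
    using At_lower[of "- \<rho> *\<^sub>R w"] by (simp only: matrix_vector_mult_diff_distrib[symmetric])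
qed

text \<open>The residual is \<open>A w\<close> for some \<open>w\<close>, so the multiplier enters only through \<open>z \<bullet> A w = A\<^sup>T z \<bullet> w\<close>, and completing
  the square in \<open>w\<close> needs no bound on \<open>z\<close> itself.\<close>

lemma AL_lower: "lower_value - (norm (transpose A *v z))\<^sup>2 / (2 * (\<rho> * \<sigma>)) \<le> AL x y z"
proof -
  obtain w where w: "res x y = A *v w" using res_in_range by blast
  have "z \<bullet> (A *v w) = (transpose A *v z) \<bullet> w" by (rule inner_matrix_vector)
  moreover have "- (norm (transpose A *v z))\<^sup>2 / (2 * (\<rho> * \<sigma>)) \<le> - ((transpose A *v z) \<bullet> w) + \<rho> * \<sigma> / 2 * (norm w)\<^sup>2"
    using rho_pos sigma_pos by (intro multiplier_term_ge) auto
  moreover have "\<rho> / 2 * (\<sigma> * (norm w)\<^sup>2) \<le> \<rho> / 2 * (norm (A *v w))\<^sup>2"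
    using rho_pos by (intro mult_left_mono A_lower) auto
  moreover have "(INF x. F x) \<le> F x" by (rule cINF_lower[OF F_bdd]) simp
  moreover have "(\<Sum>j=1..m. INF t. g j t) \<le> (\<Sum>j=1..m. g j (y j))"
    by (intro sum_mono cINF_lower g_bdd) auto
  ultimately show ?thesis unfolding aug_lagrangian_def lagrangian_def w by simp
qed

subsection \<open>The stationarity measure\<close>

lemma sdist_le:
  assumes "\<And>j. j \<in> {1..m} \<Longrightarrow> s j \<in> subdifferential (g j) (y j)"
  shows "(sdist x y z)\<^sup>2 \<le> (norm (gradient F x - transpose A *v z))\<^sup>2
     + (\<Sum>j=1..m. (norm (s j - transpose (B j) *v z))\<^sup>2) + (norm (res x y))\<^sup>2"
proof -
  let ?L = "lagrangian F g m A B c"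
  define V where "V = (gradient F x - transpose A *v z, \<lambda>j. s j - transpose (B j) *v z, - res x y)"
  have "GDERIV (\<lambda>x. ?L x y z) x :> gradient F x - transpose A *v z"
  proof -
    have f: "(F has_derivative (\<lambda>h. h \<bullet> gradient F x)) (at x)"
      using gderiv_gradient[of F x] F_smooth unfolding L_smooth_def gderiv_def by blast
    have r: "((\<lambda>x. res x y) has_derivative (\<lambda>h. A *v h)) (at x)"
      unfolding residual_def
      by (auto intro!: derivative_eq_intros bounded_linear_imp_has_derivative)
    show ?thesis
      unfolding gderiv_def lagrangian_def
      using inner_matrix_vector[of z A]
      by (auto intro!: derivative_eq_intros f r simp: inner_diff_right inner_commute)
  qed
  hence u: "gradient (\<lambda>x. ?L x y z) x = gradient F x - transpose A *v z" by (rule gradient_eqI)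
  have w: "s j - transpose (B j) *v z \<in> subdifferential (\<lambda>t. ?L x (y(j := t)) z) (y j)" if j: "j \<in> {1..m}" for j
    unfolding subdifferential_def
  proof (intro CollectI allI)
    fix t
    have "g j (y j) + s j \<bullet> (t - y j) \<le> g j t" using assms[OF j] by (simp add: subdifferential_def)
    moreover have "z \<bullet> (B j *v (t - y j)) = (transpose (B j) *v z) \<bullet> (t - y j)" by (rule inner_matrix_vector)
    moreover have "?L x (y(j := u)) z = F x + g j u + (\<Sum>i\<in>{1..m}-{j}. g i (y i))
        - z \<bullet> res x y - z \<bullet> (B j *v (u - y j))" for u
      unfolding lagrangian_def residual_upd[OF j] sum_upd[OF j] by (simp add: inner_add_right)
    ultimately show "?L x (y(j := y j)) z + (s j - transpose (B j) *v z) \<bullet> (t - y j) \<le> ?L x (y(j := t)) z"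
      by (simp add: inner_diff_left del: fun_upd_triv)
  qed
  have V: "V \<in> partial_lagrangian F g m A B c x y z"
    unfolding partial_lagrangian_def V_def using u w by (auto simp: residual_def)
  have nn: "0 \<le> stacked_norm m W" for W :: "(real^'d) \<times> (nat \<Rightarrow> real^'p) \<times> (real^'l)"
    by (cases W) (auto simp: stacked_norm_def intro!: add_nonneg_nonneg sum_nonneg)
  hence "sdist x y z \<le> stacked_norm m V"
    unfolding dist_stationary_def using V by (intro cINF_lower bdd_belowI2[of _ 0]) auto
  moreover have "0 \<le> sdist x y z"
    unfolding dist_stationary_def using V nn by (intro cINF_greatest) auto
  ultimately have "(sdist x y z)\<^sup>2 \<le> (stacked_norm m V)\<^sup>2" by (intro power_mono)
  also have "\<dots> = (norm (gradient F x - transpose A *v z))\<^sup>2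
     + (\<Sum>j=1..m. (norm (s j - transpose (B j) *v z))\<^sup>2) + (norm (res x y))\<^sup>2"
    by (simp add: stacked_norm_def V_def add_nonneg_nonneg sum_nonneg)
  finally show ?thesis .
qed

text \<open>The optimality condition of block \<open>j\<close> sees the old multiplier and the residual in the middle of the sweep; the
  stationarity condition sees the new multiplier. The multiplier step makes the difference \<open>\<rho> B\<^sub>j\<^sup>T\<close> times a
  difference of residuals, which consists of moves of \<open>x\<close> and of later blocks.\<close>

lemma y_block_bound:
  fixes x y z x' y' z' d
  defines "y' \<equiv> sweep x z y m" and "d \<equiv> x' - x"
  assumes z': "z' = z - \<rho> *\<^sub>R res x' y'" and j: "j \<in> {1..m}"
  shows "(norm (transpose (B j) *v z - \<rho> *\<^sub>R (transpose (B j) *v res x (sweep x z y j)) - H j *v (y' j - y j)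
      - transpose (B j) *v z'))\<^sup>2
    \<le> (\<rho> * \<Gamma>\<^sup>2 + \<Gamma>)\<^sup>2 * (real m + 1) * (1 + 1 / \<mu>) * ((norm d)\<^sup>2 + (\<Sum>i=1..m. wnorm_sq (H i) (y' i - y i)))"
    (is "(norm ?w)\<^sup>2 \<le> _")
proof -
  let ?D = "\<lambda>i. norm (y' i - y i)"
  define P where "P = norm d + (\<Sum>i=1..m. ?D i)"
  have P: "norm d \<le> P" "0 \<le> P" "?D j \<le> P" "(\<Sum>i=1..m. ?D i) \<le> P"
    using member_le_sum[OF j, of ?D] by (auto simp: P_def sum_nonneg intro: order_trans[OF _ le_add_same_cancel2[THEN iffD2]])
  define u where "u = res x' y' - res x (sweep x z y j)"
  have "u = A *v d + (\<Sum>i=1..m. B i *v (y' i - sweep x z y j i))"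
    unfolding u_def d_def residual_diff_x[of m A B c x' y' x] residual_diff_y[of m A B c x y' "sweep x z y j"]
    by simp
  also have "norm \<dots> \<le> \<Gamma> * norm d + (\<Sum>i=1..m. \<Gamma> * ?D i)"
  proof (intro order_trans[OF norm_triangle_ineq] add_mono A_upper order_trans[OF norm_sum] sum_mono)
    fix i assume i: "i \<in> {1..m}"
    have "norm (y' i - sweep x z y j i) \<le> ?D i"
    proof (cases "i \<le> j")
      case True
      thus ?thesis using sweep_final[of j m i x z y] j by (simp add: y'_def)
    qed (simp add: sweep_untouched)
    thus "norm (B i *v (y' i - sweep x z y j i)) \<le> \<Gamma> * ?D i"
      using Gamma_nonneg by (intro order_trans[OF B_upper[OF i]] mult_left_mono)
  qed
  also have "\<dots> = \<Gamma> * P" by (simp add: P_def sum_distrib_left distrib_left)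
  finally have u: "norm u \<le> \<Gamma> * P" .
  have "?w = \<rho> *\<^sub>R (transpose (B j) *v u) - H j *v (y' j - y j)"
    unfolding z' u_def by (simp add: algebra_simps matrix_vector_mult_scaleR matrix_vector_mult_diff_distrib)
  also have "norm \<dots> \<le> \<rho> * (\<Gamma> * (\<Gamma> * P)) + \<Gamma> * P"
  proof (intro order_trans[OF norm_triangle_ineq4] add_mono)
    have "norm (transpose (B j) *v u) \<le> \<Gamma> * (\<Gamma> * P)"
      using u Gamma_nonneg by (intro order_trans[OF Bt_upper[OF j]] mult_left_mono)
    thus "norm (\<rho> *\<^sub>R (transpose (B j) *v u)) \<le> \<rho> * (\<Gamma> * (\<Gamma> * P))" using rho_pos by simp
    show "norm (H j *v (y' j - y j)) \<le> \<Gamma> * P"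
      using P(3) Gamma_nonneg by (intro order_trans[OF H_upper[OF j]] mult_left_mono)
  qed
  also have "\<dots> = (\<rho> * \<Gamma>\<^sup>2 + \<Gamma>) * P" by (simp add: power2_eq_square algebra_simps)
  finally have "(norm ?w)\<^sup>2 \<le> ((\<rho> * \<Gamma>\<^sup>2 + \<Gamma>) * P)\<^sup>2" by (intro power_mono) auto
  also have "\<dots> = (\<rho> * \<Gamma>\<^sup>2 + \<Gamma>)\<^sup>2 * P\<^sup>2" by (simp add: power_mult_distrib)
  also have "P\<^sup>2 \<le> (real m + 1) * ((norm d)\<^sup>2 + (\<Sum>i=1..m. (?D i)\<^sup>2))"
  proof -
    define e where "e i = (if i = 0 then norm d else ?D i)" for i
    have e: "P = (\<Sum>i=0..m. e i)" "(norm d)\<^sup>2 + (\<Sum>i=1..m. (?D i)\<^sup>2) = (\<Sum>i=0..m. (e i)\<^sup>2)"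
      unfolding P_def by (simp_all add: sum.atLeast_Suc_atMost e_def)
    show ?thesis using sum_squared_le_sum_of_squares[of e "{0..m}"] unfolding e by (simp add: algebra_simps)
  qed
  also have "(norm d)\<^sup>2 + (\<Sum>i=1..m. (?D i)\<^sup>2)
      \<le> (1 + 1 / \<mu>) * ((norm d)\<^sup>2 + (\<Sum>i=1..m. wnorm_sq (H i) (y' i - y i)))"
  proof -
    have "(\<Sum>i=1..m. (?D i)\<^sup>2) \<le> (\<Sum>i=1..m. 1 / \<mu> * wnorm_sq (H i) (y' i - y i))"
      using H_lower mu_pos by (intro sum_mono) (simp add: field_simps)
    moreover have "0 \<le> (\<Sum>i=1..m. wnorm_sq (H i) (y' i - y i))"
      by (intro sum_nonneg pos_def_sigma(4)[OF H])
    moreover have "(norm d)\<^sup>2 \<le> (1 + 1 / \<mu>) * (norm d)\<^sup>2"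
      using mu_pos by (simp add: mult_le_cancel_right1)
    ultimately show ?thesis by (simp add: sum_divide_distrib[symmetric] distrib_left distrib_right)
  qed
  finally show ?thesis using Gamma_nonneg rho_pos by (simp add: mult_left_mono mult.assoc)
qed


text \<open>The budget of one iteration, in multiples of \<open>T D\<close>: the penalty gives \<open>13/2\<close>, the multiplier step costs less than
  \<open>1\<close> and the stationarity measure at most \<open>1/2\<close>, so that \<open>5\<close> remains. The multiplier step is also charged
  \<open>5/13 \<cdot> 13/4 = 5/4\<close> on the previous move \<open>D0\<close>. Its cost is taken \<open>11/10\<close> times, because the constraint violation
  in the stationarity measure is again a multiplier increment.\<close>

lemma potential_arithmetic:
  fixes AL0 AL1 D D0 E E0 N Y S \<xi> :: real
  assumes nn: "0 \<le> D" "0 \<le> D0" "0 \<le> E" "0 \<le> E0" "0 \<le> N" "0 \<le> Y" "0 \<le> \<xi>"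
    and AL: "AL1 \<le> AL0 - Y / 2 + E / (2 * L) - \<rho> * \<sigma> / 2 * D + N / \<rho>"
    and N: "\<sigma> * N \<le> 5 * (L\<^sup>2 * D0 + E0 + (3/2 * T)\<^sup>2 * D + (3/2 * T)\<^sup>2 * D0 + \<xi>)"
    and S: "S \<le> 3 * ((L\<^sup>2 + (3/2 * T)\<^sup>2) * D + E) + N / \<rho>\<^sup>2 + Cw * (D + Y)"
  shows "AL1 + \<zeta> * S + 5 * T * D
    \<le> AL0 + (1 / (2 * L) + 1 / (10 * T)) * E + 7/5 * T * D0 + 1 / (2 * T) * E0 + \<xi> / T"
proof -
  have "\<zeta> * S \<le> \<zeta> * (3 * ((L\<^sup>2 + (3/2 * T)\<^sup>2) * D + E) + N / \<rho>\<^sup>2 + Cw * (D + Y))"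
    using S zeta_pos by (intro mult_left_mono) auto
  also have "\<dots> = (\<zeta> * (3 * (L\<^sup>2 + (3/2 * T)\<^sup>2) + Cw)) * D + (3 * \<zeta>) * E + \<zeta> * (N / \<rho>\<^sup>2) + (\<zeta> * Cw) * Y"
    by (simp add: algebra_simps)
  also have "\<dots> \<le> T / 2 * D + 1 / (10 * T) * E + \<rho> / 10 * (N / \<rho>\<^sup>2) + 1 / 2 * Y"
    using nn zeta_T zeta_T' zeta_rho zeta_Cw by (intro add_mono mult_right_mono) auto
  also have "\<rho> / 10 * (N / \<rho>\<^sup>2) = 1 / 10 * (N / \<rho>)" using rho_pos by (simp add: power2_eq_square)
  finally have 1: "\<zeta> * S \<le> T / 2 * D + 1 / (10 * T) * E + 1 / 10 * (N / \<rho>) + 1 / 2 * Y" .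
  have "N / \<rho> = \<sigma> * N / (\<rho> * \<sigma>)" using sigma_pos by simp
  also have "\<dots> \<le> \<sigma> * N / (13 * T)"
    using rho_sigma T_pos nn sigma_pos by (intro divide_left_mono) auto
  also have "\<dots> \<le> 5 * (L\<^sup>2 * D0 + E0 + (3/2 * T)\<^sup>2 * D + (3/2 * T)\<^sup>2 * D0 + \<xi>) / (13 * T)"
    using T_pos by (intro divide_right_mono N) auto
  also have "\<dots> \<le> 5 * (T\<^sup>2 * D0 + E0 + (3/2 * T)\<^sup>2 * D + (3/2 * T)\<^sup>2 * D0 + \<xi>) / (13 * T)"
    using T_pos L_pos L_le_T nn
    by (intro divide_right_mono mult_left_mono add_mono mult_right_mono power_mono) auto
  also have "\<dots> = 5/13 * (13/4 * (T * D0) + E0 / T + 9/4 * (T * D) + \<xi> / T)"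
    using T_pos by (simp add: field_simps power2_eq_square)
  finally have 2: "N / \<rho> \<le> 5/13 * (13/4 * (T * D0) + E0 / T + 9/4 * (T * D) + \<xi> / T)" .
  have 3: "13 / 2 * (T * D) \<le> \<rho> * \<sigma> / 2 * D"
    using mult_right_mono[OF rho_sigma nn(1)] by (simp add: algebra_simps)
  have 4: "0 \<le> T * D" "0 \<le> T * D0" "0 \<le> E0 / T" "0 \<le> \<xi> / T" "0 \<le> E / T"
    using nn T_pos by auto
  have 5: "(1 / (2 * L) + 1 / (10 * T)) * E = E / (2 * L) + 1 / 10 * (E / T)" "1 / (10 * T) * E = 1 / 10 * (E / T)"
    "1 / (2 * T) * E0 = 1 / 2 * (E0 / T)" "T / 2 * D = 1 / 2 * (T * D)" "5 * T * D = 5 * (T * D)"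
    "7 / 5 * T * D0 = 7 / 5 * (T * D0)"
    by (simp_all add: field_simps)
  define tD tD0 tE tE0 tX eL rs nr zS where defs: "tD = T * D" "tD0 = T * D0" "tE = E / T" "tE0 = E0 / T"
    "tX = \<xi> / T" "eL = E / (2 * L)" "rs = \<rho> * \<sigma> / 2 * D" "nr = N / \<rho>" "zS = \<zeta> * S"
  show ?thesis
    using 1[unfolded 5, folded defs] 2[folded defs] 3[folded defs] 4[folded defs] AL[folded defs]
    unfolding 5 defs[symmetric] by argo
qed

text \<open>Here \<open>xp\<close>, \<open>vp\<close> are the previous iterate and gradient estimate. The bound on \<open>v - vp\<close> holds both for
  mini-batch increments, where each summand is Lipschitz, and for full gradients. The defect \<open>\<xi>\<close> in the optimality relation
  for the incoming multiplier is zero except in the very first iteration, whose multiplier is arbitrary.\<close>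

lemma iteration_inequality:
  fixes xp x vp v y z
  defines "y' \<equiv> sweep x z y m"
  defines "x' \<equiv> x_update m A B c \<eta> \<rho> G v x y' z"
  defines "z' \<equiv> z - \<rho> *\<^sub>R res x' y'"
  assumes v: "norm (v - vp) \<le> L * norm (x - xp) + norm (vp - gradient F xp)"
    and \<xi>: "norm (transpose A *v z - (vp + (1 / \<eta>) *\<^sub>R (G *v (x - xp)))) \<le> \<xi>"
  shows "transpose A *v z' = v + (1 / \<eta>) *\<^sub>R (G *v (x' - x))"
    and "AL x' y' z' + \<zeta> * (sdist x' y' z')\<^sup>2 + 5 * T * (norm (x' - x))\<^sup>2
    \<le> AL x y z + (1 / (2 * L) + 1 / (10 * T)) * (norm (v - gradient F x))\<^sup>2
       + 7/5 * T * (norm (x - xp))\<^sup>2 + 1 / (2 * T) * (norm (vp - gradient F xp))\<^sup>2 + \<xi>\<^sup>2 / T"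
proof -
  show Az': "transpose A *v z' = v + (1 / \<eta>) *\<^sub>R (G *v (x' - x))"
    unfolding z'_def x'_def by (rule x_update_optimality[symmetric])
  define Y where "Y = (\<Sum>j=1..m. wnorm_sq (H j) (y' j - y j))"
  define M where "M u = (1 / \<eta>) *\<^sub>R (G *v u)" for u
  have M: "norm (M u) \<le> 3/2 * T * norm u" for u unfolding M_def by (rule G_upper)
  have Y: "0 \<le> Y" unfolding Y_def by (intro sum_nonneg pos_def_sigma(4)[OF H])
  have z': "z' = z - \<rho> *\<^sub>R res x' y'" by (simp add: z'_def)
  have sw: "AL x y' z + 1 / 2 * Y \<le> AL x y z" unfolding y'_def Y_def by (rule sweep_descent) simp
  have xd: "AL x' y' z \<le> AL x y' z + (norm (v - gradient F x))\<^sup>2 / (2 * L) - \<rho> * \<sigma> / 2 * (norm (x' - x))\<^sup>2"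
    unfolding x'_def by (rule x_update_descent)
  have AL: "AL x' y' z' \<le> AL x y z - Y / 2 + (norm (v - gradient F x))\<^sup>2 / (2 * L)
       - \<rho> * \<sigma> / 2 * (norm (x' - x))\<^sup>2 + (norm (z' - z))\<^sup>2 / \<rho>"
    using sw xd multiplier_update(1)[OF z'] by linarith
  let ?a = "L * norm (x - xp)" and ?b = "norm (vp - gradient F xp)" and ?c = "3/2 * T * norm (x' - x)"
    and ?d = "3/2 * T * norm (x - xp)"
  have N: "\<sigma> * (norm (z' - z))\<^sup>2 \<le> 5 * (L\<^sup>2 * (norm (x - xp))\<^sup>2 + ?b\<^sup>2 + (3/2 * T)\<^sup>2 * (norm (x' - x))\<^sup>2
      + (3/2 * T)\<^sup>2 * (norm (x - xp))\<^sup>2 + \<xi>\<^sup>2)"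
  proof -
    have "transpose A *v z' - transpose A *v z
      = (v - vp) + M (x' - x) - M (x - xp) - (transpose A *v z - (vp + M (x - xp)))"
      unfolding Az' M_def by simp
    also have "norm \<dots> \<le> (?a + ?b) + ?c + ?d + \<xi>"
      using v \<xi>[folded M_def] M[of "x' - x"] M[of "x - xp"]
        norm_triangle_ineq4[of "(v - vp) + M (x' - x) - M (x - xp)" "transpose A *v z - (vp + M (x - xp))"]
        norm_triangle_ineq4[of "(v - vp) + M (x' - x)" "M (x - xp)"] norm_triangle_ineq[of "v - vp" "M (x' - x)"]
      by linarith
    finally have "(norm (transpose A *v z' - transpose A *v z))\<^sup>2 \<le> (?a + ?b + ?c + ?d + \<xi>)\<^sup>2"
      by (intro power_mono) auto
    also note five_term_square_le
    finally show ?thesis using multiplier_update(2)[OF z'] unfolding power_mult_distrib by linarith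
  qed
  have S: "(sdist x' y' z')\<^sup>2 \<le> 3 * ((L\<^sup>2 + (3/2 * T)\<^sup>2) * (norm (x' - x))\<^sup>2 + (norm (v - gradient F x))\<^sup>2)
      + (norm (z' - z))\<^sup>2 / \<rho>\<^sup>2 + Cw * ((norm (x' - x))\<^sup>2 + Y)"
  proof -
    define s where "s j = transpose (B j) *v z - \<rho> *\<^sub>R (transpose (B j) *v res x (sweep x z y j))
      - H j *v (y' j - y j)" for j
    have "(sdist x' y' z')\<^sup>2 \<le> (norm (gradient F x' - transpose A *v z'))\<^sup>2
     + (\<Sum>j=1..m. (norm (s j - transpose (B j) *v z'))\<^sup>2) + (norm (res x' y'))\<^sup>2"

    proof (rule sdist_le)
      fix j assume "j \<in> {1..m}"
      thus "s j \<in> subdifferential (g j) (y' j)" unfolding s_def y'_def by (rule sweep_subgradient)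
    qed
    also have "(norm (gradient F x' - transpose A *v z'))\<^sup>2
       \<le> 3 * ((L\<^sup>2 + (3/2 * T)\<^sup>2) * (norm (x' - x))\<^sup>2 + (norm (v - gradient F x))\<^sup>2)"
    proof -
      let ?l = "L * norm (x' - x)" and ?e = "norm (v - gradient F x)"
      have "gradient F x' - transpose A *v z' = (gradient F x' - gradient F x) - (v - gradient F x) - M (x' - x)"
        unfolding Az' M_def by simp
      also have "norm \<dots> \<le> ?l + ?e + ?c"
        by (intro order_trans[OF norm_triangle_ineq4] add_mono M F_gradient_lipschitz order_refl)
      finally have "(norm (gradient F x' - transpose A *v z'))\<^sup>2 \<le> (?l + ?e + ?c)\<^sup>2" by (intro power_mono) auto
      also have "\<dots> \<le> 3 * (?l\<^sup>2 + ?e\<^sup>2 + ?c\<^sup>2)"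
      proof -
        have "0 \<le> (?l - ?e)\<^sup>2 + (?l - ?c)\<^sup>2 + (?e - ?c)\<^sup>2" by simp
        thus ?thesis by (simp add: power2_eq_square algebra_simps)
      qed
      finally show ?thesis unfolding power_mult_distrib by (simp add: algebra_simps)
    qed
    also have "(\<Sum>j=1..m. (norm (s j - transpose (B j) *v z'))\<^sup>2)
      \<le> (\<Sum>j=1..m. (\<rho> * \<Gamma>\<^sup>2 + \<Gamma>)\<^sup>2 * (real m + 1) * (1 + 1 / \<mu>) * ((norm (x' - x))\<^sup>2 + Y))"
      using y_block_bound[of z' z x' x y] z' unfolding s_def Y_def y'_def by (intro sum_mono) auto
    also have "\<dots> = Cw * ((norm (x' - x))\<^sup>2 + Y)" by (simp add: Cw)
    finally show ?thesis unfolding multiplier_update(3)[OF z'] by simp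
  qed
  show "AL x' y' z' + \<zeta> * (sdist x' y' z')\<^sup>2 + 5 * T * (norm (x' - x))\<^sup>2
    \<le> AL x y z + (1 / (2 * L) + 1 / (10 * T)) * (norm (v - gradient F x))\<^sup>2
       + 7/5 * T * (norm (x - xp))\<^sup>2 + 1 / (2 * T) * (norm (vp - gradient F xp))\<^sup>2 + \<xi>\<^sup>2 / T"
    by (rule potential_arithmetic[OF _ _ _ _ _ _ _ AL N S]) (use Y in auto)
qed

end

section \<open>Mini-batch estimators\<close>

lemma expectation_bind_finite:
  fixes h :: "'b \<Rightarrow> real"
  assumes "finite (set_pmf p)" "\<And>s. s \<in> set_pmf p \<Longrightarrow> finite (set_pmf (f s))"
  shows "measure_pmf.expectation (p \<bind> f) h = measure_pmf.expectation p (\<lambda>s. measure_pmf.expectation (f s) h)"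
  using assms by (subst pmf_expectation_bind[of "set_pmf p"]) (auto simp: integral_measure_pmf[of "set_pmf p"])

lemma expectation_mono_finite:
  fixes h h' :: "'a \<Rightarrow> real"
  assumes "finite (set_pmf p)" "\<And>s. s \<in> set_pmf p \<Longrightarrow> h s \<le> h' s"
  shows "measure_pmf.expectation p h \<le> measure_pmf.expectation p h'"
  using assms by (intro integral_mono_AE integrable_measure_pmf_finite) (auto simp: AE_measure_pmf_iff)

lemma finite_set_replicate_pmf: "finite (set_pmf p) \<Longrightarrow> finite (set_pmf (replicate_pmf b p))"
  by (induction b) auto

text \<open>The draws are independent and centred, so all cross terms vanish.\<close>

lemma expectation_norm_sum_list_square:
  fixes h :: "'i \<Rightarrow> 'a::real_inner"
  assumes fin: "finite (set_pmf p)" and mean: "\<And>u. measure_pmf.expectation p (\<lambda>i. u \<bullet> h i) = 0"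
  shows "measure_pmf.expectation (replicate_pmf b p) (\<lambda>is. (norm (a + (\<Sum>i\<leftarrow>is. h i)))\<^sup>2)
    = (norm a)\<^sup>2 + real b * measure_pmf.expectation p (\<lambda>i. (norm (h i))\<^sup>2)"
proof (induction b arbitrary: a)
  case (Suc b)
  let ?V = "measure_pmf.expectation p (\<lambda>i. (norm (h i))\<^sup>2)"
  have int: "integrable (measure_pmf p) f" for f :: "'i \<Rightarrow> real" by (rule integrable_measure_pmf_finite[OF fin])
  have "replicate_pmf (Suc b) p = p \<bind> (\<lambda>x. map_pmf ((#) x) (replicate_pmf b p))"
    by (simp add: map_pmf_def)
  hence "measure_pmf.expectation (replicate_pmf (Suc b) p) (\<lambda>is. (norm (a + (\<Sum>i\<leftarrow>is. h i)))\<^sup>2)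
     = measure_pmf.expectation p (\<lambda>i. measure_pmf.expectation (replicate_pmf b p) (\<lambda>is. (norm ((a + h i) + (\<Sum>i\<leftarrow>is. h i)))\<^sup>2))"
    using fin finite_set_replicate_pmf[OF fin] by (simp add: expectation_bind_finite add.assoc)
  also have "\<dots> = measure_pmf.expectation p (\<lambda>i. ((norm a)\<^sup>2 + real b * ?V) + (2 * (a \<bullet> h i) + (norm (h i))\<^sup>2))"
    unfolding Suc.IH by (simp add: power2_norm_add algebra_simps)
  also have "\<dots> = ((norm a)\<^sup>2 + real b * ?V) + ?V"
    using mean[of a] by (simp add: int)
  finally show ?case by (simp add: algebra_simps)
qed simp

text \<open>Centring only reduces the second moment, so the batch mean deviates from \<open>u\<close> by at most \<open>r\<^sup>2 / q\<close> in mean square.\<close>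

lemma minibatch_mean_square:
  fixes w :: "nat \<Rightarrow> 'a::real_inner"
  assumes n: "1 \<le> n" and q: "1 \<le> q" and w: "\<And>i. i \<in> {1..n} \<Longrightarrow> norm (w i) \<le> r"
  defines "u \<equiv> (1 / real n) *\<^sub>R (\<Sum>i=1..n. w i)"
  shows "measure_pmf.expectation (replicate_pmf q (pmf_of_set {1..n}))
      (\<lambda>is. (norm (e + ((1 / real q) *\<^sub>R (\<Sum>i\<leftarrow>is. w i) - u)))\<^sup>2) \<le> (norm e)\<^sup>2 + r\<^sup>2 / real q"
proof -
  let ?p = "pmf_of_set {1..n}"
  define h where "h i = (1 / real q) *\<^sub>R (w i - u)" for i
  have fin: "finite (set_pmf ?p)" using n by simp
  have su: "(\<Sum>i=1..n. w i) = real n *\<^sub>R u" using n by (simp add: u_def)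
  have E: "measure_pmf.expectation ?p f = (\<Sum>i=1..n. f i) / real n" for f :: "nat \<Rightarrow> real"
    using n by (subst integral_pmf_of_set) auto
  have mean: "measure_pmf.expectation ?p (\<lambda>i. v \<bullet> h i) = 0" for v
    unfolding E h_def using su
    by (simp add: sum_divide_distrib[symmetric] inner_sum_right[symmetric] sum_subtractf scaleR_sum_right[symmetric] sum_constant_scaleR)
  have var: "measure_pmf.expectation ?p (\<lambda>i. (norm (h i))\<^sup>2) \<le> r\<^sup>2 / (real q)\<^sup>2"
  proof -
    have "(\<Sum>i=1..n. (norm (w i - u))\<^sup>2) = (\<Sum>i=1..n. (norm (w i))\<^sup>2) - 2 * ((\<Sum>i=1..n. w i) \<bullet> u) + real n * (norm u)\<^sup>2"
      by (simp add: power2_norm_eq_inner inner_diff_left inner_diff_right inner_commute sum_subtractf sum.distrib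
          inner_sum_right sum_distrib_left algebra_simps)
    also have "\<dots> \<le> (\<Sum>i=1..n. (norm (w i))\<^sup>2)" unfolding su by (simp add: power2_norm_eq_inner)
    also have "\<dots> \<le> (\<Sum>i=1..n. r\<^sup>2)" by (intro sum_mono power_mono w) auto
    finally have "(\<Sum>i=1..n. (norm (w i - u))\<^sup>2) / real n \<le> r\<^sup>2" using n by (simp add: field_simps)
    moreover have "measure_pmf.expectation ?p (\<lambda>i. (norm (h i))\<^sup>2) = (\<Sum>i=1..n. (norm (w i - u))\<^sup>2) / real n / (real q)\<^sup>2"
      unfolding E h_def by (simp add: power_divide sum_divide_distrib[symmetric])
    ultimately show ?thesis by (simp only: divide_right_mono zero_le_power2)
  qed
  have split: "(1 / real q) *\<^sub>R (\<Sum>i\<leftarrow>is. w i) - u = (\<Sum>i\<leftarrow>is. h i)" if "length is = q" for "is"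
  proof -
    have "(\<Sum>i\<leftarrow>is. h i) = (1 / real q) *\<^sub>R ((\<Sum>i\<leftarrow>is. w i) - real (length is) *\<^sub>R u)"
      by (induction "is") (auto simp: h_def algebra_simps)
    thus ?thesis using that q by (simp add: scaleR_diff_right)
  qed
  have "measure_pmf.expectation (replicate_pmf q ?p) (\<lambda>is. (norm (e + ((1 / real q) *\<^sub>R (\<Sum>i\<leftarrow>is. w i) - u)))\<^sup>2)
    = measure_pmf.expectation (replicate_pmf q ?p) (\<lambda>is. (norm (e + (\<Sum>i\<leftarrow>is. h i)))\<^sup>2)"
    by (intro integral_cong_AE) (auto simp: AE_measure_pmf_iff set_replicate_pmf split)
  also have "\<dots> = (norm e)\<^sup>2 + real q * measure_pmf.expectation ?p (\<lambda>i. (norm (h i))\<^sup>2)"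
    by (rule expectation_norm_sum_list_square[OF fin mean])
  also have "\<dots> \<le> (norm e)\<^sup>2 + real q * (r\<^sup>2 / (real q)\<^sup>2)"
    using var by (intro add_left_mono mult_left_mono) auto
  also have "\<dots> = (norm e)\<^sup>2 + r\<^sup>2 / real q" using q by (simp add: power2_eq_square)
  finally show ?thesis .
qed

section \<open>Summation of the expected inequalities\<close>

text \<open>Between two full gradients the error grows by \<open>a D k / q\<close> per iteration, and each such contribution survives in
  fewer than \<open>q\<close> later errors; hence batch size equal to the period makes the bound independent of \<open>q\<close>.\<close>

lemma reset_error_sum:
  fixes D E :: "nat \<Rightarrow> real"
  assumes q: "1 \<le> q" and E: "\<And>k. 0 \<le> E k" and D: "\<And>k. 0 \<le> D k"
    and rec: "\<And>k. E (Suc k) \<le> (if k mod q = 0 then 0 else E k + a / real q * D k)" and a: "0 \<le> a"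
  shows "(\<Sum>k=1..K. E k) \<le> a * (\<Sum>k<K. D k)"
proof -
  \<comment> \<open>\<open>w k\<close> is the number of further iterations that reuse the error \<open>E k\<close>.\<close>
  define w where "w k = real ((q - k mod q) mod q)" for k
  have "(\<Sum>k=1..K. E k) + w K * E K \<le> a * (\<Sum>k<K. D k)"
  proof (induction K)
    case (Suc K)
    show ?case
    proof (cases "K mod q = 0")
      case True
      hence "E (Suc K) = 0" using rec[of K] E[of "Suc K"] by simp
      moreover have "0 \<le> w K * E K" using E by (simp add: w_def)
      moreover have "0 \<le> a * D K" using a D by simp
      ultimately show ?thesis using Suc.IH by (simp add: algebra_simps)
    next
      case False
      have lt: "K mod q < q" using q by simp
      have w: "w K = w (Suc K) + 1" "w K \<le> real q"
        using False lt q by (auto simp: w_def mod_Suc of_nat_diff Suc_le_eq)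
      have "w K * E (Suc K) \<le> w K * (E K + a / real q * D K)"
        using rec[of K] False by (intro mult_left_mono) (auto simp: w_def)
      also have "\<dots> = w K * E K + w K * (a / real q * D K)" by (simp add: algebra_simps)
      also have "w K * (a / real q * D K) \<le> real q * (a / real q * D K)"
        using w(2) a D q by (intro mult_right_mono) auto
      also have "\<dots> = a * D K" using q by simp
      finally have "E (Suc K) + w (Suc K) * E (Suc K) \<le> w K * E K + a * D K" by (simp add: w(1) algebra_simps)
      thus ?thesis using Suc.IH by (simp add: algebra_simps)
    qed
  qed (simp add: w_def)
  moreover have "0 \<le> w K * E K" using E by (simp add: w_def)
  ultimately show ?thesis by linarith
qed

text \<open>Telescoping leaves \<open>5\<close> times \<open>T \<Sum> D\<close> on the left. On the right, with \<open>\<Sum> E \<le> L\<^sup>2 \<Sum> D\<close>, there are \<open>7/5\<close> from previous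
  moves, \<open>1/2 + 1/10 + 1/2\<close> from the errors and \<open>3/26 + 27/104\<close> from the lower bound on \<open>a K\<close>: less than \<open>3\<close> altogether.\<close>

lemma potential_summation:
  fixes a D E S :: "nat \<Rightarrow> real" and \<xi> l \<zeta> L T :: real
  assumes q: "1 \<le> q" and nn: "\<And>k. 0 \<le> E k" "\<And>k. 0 \<le> D k" and L: "0 < L" "L \<le> T" and \<xi>: "0 \<le> \<xi>"
    and step: "\<And>k. a (Suc k) + \<zeta> * S (Suc k) + 5 * T * D (Suc k)
       \<le> a k + (1 / (2 * L) + 1 / (10 * T)) * E (Suc k) + 7/5 * T * D k + 1 / (2 * T) * E k + (if k = 0 then \<xi> else 0)"
    and lower: "\<And>k. 1 \<le> k \<Longrightarrow> l - 3 * (\<delta>\<^sup>2 + E k + (3/2 * T)\<^sup>2 * D k) / (26 * T) \<le> a k"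
    and rec: "\<And>k. E (Suc k) \<le> (if k mod q = 0 then 0 else E k + L\<^sup>2 / real q * D k)"
    and init: "D 0 = 0" "E 0 \<le> \<delta>\<^sup>2" and K: "1 \<le> K"
  shows "\<zeta> * (\<Sum>k=1..K. S k) \<le> a 0 - l + \<xi> + \<delta>\<^sup>2 / T"
proof -
  have T: "0 < T" using L by simp
  let ?SD = "\<Sum>k=1..K. D k" and ?SE = "\<Sum>k=1..K. E k"
  have tele: "a K + \<zeta> * (\<Sum>k=1..K. S k) + 5 * T * (\<Sum>k=1..K. D k)
     \<le> a 0 + (1 / (2 * L) + 1 / (10 * T)) * (\<Sum>k=1..K. E k) + 7/5 * T * (\<Sum>k<K. D k) + 1 / (2 * T) * (\<Sum>k<K. E k)
       + (if K = 0 then 0 else \<xi>)" for K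
  proof (induction K)
    case (Suc K)
    show ?case using Suc.IH step[of K] by (auto simp: distrib_left split: if_splits)
  qed simp
  have shift: "(\<Sum>k<K. f k) = f 0 + (\<Sum>k=1..K. f k) - f K" for f :: "nat \<Rightarrow> real"
  proof -
    have "(\<Sum>k<K. f k) + f K = (\<Sum>k<Suc K. f k)" by simp
    also have "\<dots> = f 0 + (\<Sum>k=1..K. f k)"
      by (simp add: lessThan_Suc_atMost atMost_atLeast0 sum.atLeast_Suc_atMost)
    finally show ?thesis by simp
  qed
  have SD: "(\<Sum>k<K. D k) \<le> ?SD" "0 \<le> ?SD" "D K \<le> ?SD"
    using shift[of D] init nn(2)[of K] member_le_sum[of K "{1..K}" D] nn K by (auto intro: sum_nonneg)
  have SE0: "(\<Sum>k<K. E k) \<le> \<delta>\<^sup>2 + ?SE" "0 \<le> ?SE" "E K \<le> ?SE"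
    using shift[of E] init(2) nn(1)[of K] member_le_sum[of K "{1..K}" E] nn K by (linarith, auto intro: sum_nonneg)
  have SE: "?SE \<le> L\<^sup>2 * ?SD"
    using reset_error_sum[OF q nn rec, of K] mult_left_mono[OF SD(1), of "L\<^sup>2"] by simp
  define X where "X = T * ?SD"
  have X: "0 \<le> X" using T SD by (simp add: X_def)
  have 1: "?SE / (2 * L) \<le> 1 / 2 * X"
  proof -
    have "?SE / (2 * L) \<le> L\<^sup>2 * ?SD / (2 * L)" using SE L by (intro divide_right_mono) auto
    also have "\<dots> = 1 / 2 * (L * ?SD)" using L by (simp add: power2_eq_square)
    also have "\<dots> \<le> 1 / 2 * X" using mult_right_mono[OF L(2) SD(2)] by (simp add: X_def)
    finally show ?thesis .
  qed
  have 2: "?SE / T \<le> X"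
  proof -
    have "?SE \<le> T\<^sup>2 * ?SD"
      using SE L SD(2) by (elim order_trans) (intro mult_right_mono power_mono, auto)
    thus ?thesis using T by (simp add: X_def field_simps power2_eq_square)
  qed
  have 3: "7/5 * T * (\<Sum>k<K. D k) \<le> 7/5 * X"
    using mult_left_mono[OF SD(1), of T] T by (simp add: X_def)
  have 4: "1 / (2 * T) * (\<Sum>k<K. E k) \<le> 1/2 * (\<delta>\<^sup>2 / T) + 1/2 * (?SE / T)"
    using divide_right_mono[OF SE0(1), of "2 * T"] T by (simp add: add_divide_distrib)
  have 5: "(1 / (2 * L) + 1 / (10 * T)) * ?SE = ?SE / (2 * L) + 1/10 * (?SE / T)" by (simp add: algebra_simps)
  have 6: "3 * (\<delta>\<^sup>2 + E K + (3/2 * T)\<^sup>2 * D K) / (26 * T) \<le> 3/26 * (\<delta>\<^sup>2 / T) + 3/26 * (?SE / T) + 27/104 * X"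
  proof -
    have "3 * (\<delta>\<^sup>2 + E K + (3/2 * T)\<^sup>2 * D K) / (26 * T) \<le> 3 * (\<delta>\<^sup>2 + ?SE + (3/2 * T)\<^sup>2 * ?SD) / (26 * T)"
      using T SD SE0 by (intro divide_right_mono mult_left_mono add_mono) auto
    also have "\<dots> = 3/26 * (\<delta>\<^sup>2 / T) + 3/26 * (?SE / T) + 27/104 * X"
      using T by (simp add: X_def field_simps power2_eq_square)
    finally show ?thesis .
  qed
  have 7: "5 * T * ?SD = 5 * X" by (simp add: X_def)
  have 8: "0 \<le> \<delta>\<^sup>2 / T" using T by simp
  have 9: "(if K = 0 then 0 else \<xi>) = \<xi>" using K by simp
  show ?thesis using tele[of K, unfolded 5 7 9] 1 2 3 4 6 8 X lower[OF K] by argo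
qed

text \<open>The number of full gradients among the first \<open>K\<close> iterations is \<open>K / q\<close> rounded up.\<close>

lemma sum_reset_cost:
  assumes q: "1 \<le> q"
  shows "(\<Sum>k<K. if k mod q = 0 then (1::nat) else 0) * q = K + (if K mod q = 0 then 0 else q - K mod q)"
proof (induction K)
  case (Suc K)
  have "K mod q < q" using q by simp
    hence "Suc (K mod q) = q \<or> Suc (K mod q) < q" by linarith
  thus ?case using Suc.IH q by (auto simp: mod_Suc add_mult_distrib Suc_diff_Suc split: if_splits)
qed simp

section \<open>Convergence of SPIDER-ADMM\<close>

context spider_admm
begin

abbreviation "estimator \<equiv> spider_estimator n fi q q"
abbreviation "step \<equiv> spider_step n fi g m A B c q q \<eta> \<rho> G H"
abbreviation "run \<equiv> spider_run n fi g m A B c q q \<eta> \<rho> G H"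

definition move_sq :: "('d, 'p, 'l) spider_state \<Rightarrow> real" where
  "move_sq s = (norm (x_cur s - x_prev s))\<^sup>2"

definition error_sq :: "('d, 'p, 'l) spider_state \<Rightarrow> real" where
  "error_sq s = (norm (v_prev s - gradient F (x_prev s)))\<^sup>2"

definition AL_at :: "('d, 'p, 'l) spider_state \<Rightarrow> real" where
  "AL_at s = AL (x_cur s) (y_cur s) (z_cur s)"

definition sdist_sq :: "('d, 'p, 'l) spider_state \<Rightarrow> real" where
  "sdist_sq s = (sdist (x_cur s) (y_cur s) (z_cur s))\<^sup>2"

text \<open>Zero after every iteration, by optimality of the \<open>x\<close>-update, and \<open>A\<^sup>T z\<^sub>0\<close> in the initial state.\<close>

definition multiplier_defect :: "('d, 'p, 'l) spider_state \<Rightarrow> real^'d" where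
  "multiplier_defect s = transpose A *v z_cur s - (v_prev s + (1 / \<eta>) *\<^sub>R (G *v (x_cur s - x_prev s)))"

definition successor :: "('d, 'p, 'l) spider_state \<Rightarrow> (real^'d) \<times> nat \<Rightarrow> ('d, 'p, 'l) spider_state" where
  "successor s = (\<lambda>(v, calls).
     let y' = sweep (x_cur s) (z_cur s) (y_cur s) m;
         x' = x_update m A B c \<eta> \<rho> G v (x_cur s) y' (z_cur s)
     in \<lparr>x_prev = x_cur s, x_cur = x', v_prev = v, y_cur = y', z_cur = z_cur s - \<rho> *\<^sub>R res x' y',
         ifo_calls = ifo_calls s + calls\<rparr>)"

lemma step_eq: "step k s = map_pmf (successor s) (estimator k s)"
  by (simp add: spider_step_def map_pmf_def successor_def case_prod_beta' Let_def)

lemma finite_estimator: "finite (set_pmf (estimator k s))"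
  using n by (auto simp: spider_estimator_def intro!: finite_imageI finite_set_replicate_pmf)

lemma finite_run: "finite (set_pmf (run x0 y0 z0 k))"
  by (induction k) (auto simp: step_eq finite_estimator)

text \<open>At a reset the two estimates differ by a gradient increment and the old error; otherwise by an average of
  increments of the \<open>f\<^sub>i\<close>. Both are covered by one bound that holds for every outcome of the sampling.\<close>

lemma estimator_support:
  assumes "(v, calls) \<in> set_pmf (estimator k s)"
  shows "norm (v - v_prev s) \<le> L * norm (x_cur s - x_prev s) + norm (v_prev s - gradient F (x_prev s))"
    and "calls = (if k mod q = 0 then n else 2 * q)"
proof -
  show "calls = (if k mod q = 0 then n else 2 * q)"
    using assms by (auto simp: spider_estimator_def split: if_splits)
  show "norm (v - v_prev s) \<le> L * norm (x_cur s - x_prev s) + norm (v_prev s - gradient F (x_prev s))"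
  proof (cases "k mod q = 0")
    case True
    hence "v - v_prev s = (gradient F (x_cur s) - gradient F (x_prev s)) - (v_prev s - gradient F (x_prev s))"
      using assms by (simp add: spider_estimator_def)
    thus ?thesis
      using norm_triangle_ineq4[of "gradient F (x_cur s) - gradient F (x_prev s)" "v_prev s - gradient F (x_prev s)"]
        F_gradient_lipschitz[of "x_cur s" "x_prev s"] by simp
  next
    case False
    let ?w = "\<lambda>i. gradient (fi i) (x_cur s) - gradient (fi i) (x_prev s)"
    obtain xs where xs: "set xs \<subseteq> {1..n}" "length xs = q" "v = (1 / real q) *\<^sub>R (\<Sum>i\<leftarrow>xs. ?w i) + v_prev s"
      using assms False n by (auto simp: spider_estimator_def set_replicate_pmf in_lists_conv_set subset_iff)
    have "norm (\<Sum>i\<leftarrow>xs. ?w i) \<le> real (length xs) * (L * norm (x_cur s - x_prev s))"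
      using xs(1)
    proof (induction xs)
      case (Cons i xs)
      have "i \<in> {1..n}" using Cons.prems by simp
      hence "norm (?w i) \<le> L * norm (x_cur s - x_prev s)"
        using standing by (auto simp: standing_assumptions_def L_smooth_def)
      thus ?case
        using Cons norm_triangle_ineq[of "?w i" "\<Sum>i\<leftarrow>xs. ?w i"] by (simp add: algebra_simps)
    qed simp
    hence "norm (v - v_prev s) \<le> L * norm (x_cur s - x_prev s)"
      using xs q by (simp add: field_simps)
    thus ?thesis using norm_ge_zero[of "v_prev s - gradient F (x_prev s)"] by linarith
  qed
qed

lemma estimator_error:
  "measure_pmf.expectation (estimator k s) (\<lambda>(v, calls). (norm (v - gradient F (x_cur s)))\<^sup>2)
    \<le> (if k mod q = 0 then 0 else error_sq s + L\<^sup>2 / real q * move_sq s)"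
proof (cases "k mod q = 0")
  case False
  let ?w = "\<lambda>i. gradient (fi i) (x_cur s) - gradient (fi i) (x_prev s)"
  let ?e = "v_prev s - gradient F (x_prev s)"
  have sm: "\<forall>i\<in>{1..n}. L_smooth L (fi i)" using standing by (simp add: standing_assumptions_def)
  define u where "u = (1 / real n) *\<^sub>R (\<Sum>i=1..n. ?w i)"
  have u: "u = gradient F (x_cur s) - gradient F (x_prev s)"
    by (simp add: u_def gradient_eqI[OF gradient_favg[OF sm]] sum_subtractf scaleR_diff_right)
  have "measure_pmf.expectation (estimator k s) (\<lambda>(v, calls). (norm (v - gradient F (x_cur s)))\<^sup>2)
    = measure_pmf.expectation (replicate_pmf q (pmf_of_set {1..n}))
        (\<lambda>is. (norm (?e + ((1 / real q) *\<^sub>R (\<Sum>i\<leftarrow>is. ?w i) - u)))\<^sup>2)"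
    using False by (simp add: spider_estimator_def u algebra_simps)
  also have "\<dots> \<le> (norm ?e)\<^sup>2 + (L * norm (x_cur s - x_prev s))\<^sup>2 / real q"
    unfolding u_def using sm by (intro minibatch_mean_square n q) (auto simp: L_smooth_def)
  finally show ?thesis using False by (simp add: error_sq_def move_sq_def power_mult_distrib)
qed (simp add: spider_estimator_def)

lemma step_support:
  assumes s': "s' \<in> set_pmf (step k s)" and \<xi>: "norm (multiplier_defect s) \<le> \<xi>"
  shows "multiplier_defect s' = 0"
    and "AL_at s' + \<zeta> * sdist_sq s' + 5 * T * move_sq s' - (1 / (2 * L) + 1 / (10 * T)) * error_sq s'
      \<le> AL_at s + 7/5 * T * move_sq s + 1 / (2 * T) * error_sq s + \<xi>\<^sup>2 / T"
    and "ifo_calls s' = ifo_calls s + (if k mod q = 0 then n else 2 * q)"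
proof -
  obtain v calls where vc: "(v, calls) \<in> set_pmf (estimator k s)" and s'_eq: "s' = successor s (v, calls)"
    using s' unfolding step_eq by auto
  note v = estimator_support(1)[OF vc]
  note ineq = iteration_inequality[where x="x_cur s" and xp="x_prev s" and vp="v_prev s" and y="y_cur s"
      and z="z_cur s", OF v \<xi>[unfolded multiplier_defect_def]]
  show "multiplier_defect s' = 0"
    using ineq(1) by (simp add: s'_eq successor_def multiplier_defect_def Let_def)
  show "AL_at s' + \<zeta> * sdist_sq s' + 5 * T * move_sq s' - (1 / (2 * L) + 1 / (10 * T)) * error_sq s'
      \<le> AL_at s + 7/5 * T * move_sq s + 1 / (2 * T) * error_sq s + \<xi>\<^sup>2 / T"
    using ineq(2) by (simp add: s'_eq successor_def Let_def AL_at_def sdist_sq_def move_sq_def error_sq_def)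
  show "ifo_calls s' = ifo_calls s + (if k mod q = 0 then n else 2 * q)"
    using estimator_support(2)[OF vc] by (simp add: s'_eq successor_def Let_def)
qed

lemma run_defect:
  assumes "s \<in> set_pmf (run x0 y0 z0 k)"
  shows "norm (multiplier_defect s) \<le> (if k = 0 then norm (transpose A *v z0) else 0)"
proof (cases k)
  case 0
  thus ?thesis using assms by (simp add: multiplier_defect_def)
next
  case (Suc j)
  then obtain s0 where "s0 \<in> set_pmf (run x0 y0 z0 j)" "s \<in> set_pmf (step j s0)" using assms by auto
  thus ?thesis using step_support(1)[of s j s0, OF _ order_refl] Suc by simp
qed

lemma run_ifo_calls:
  assumes "s \<in> set_pmf (run x0 y0 z0 k)"
  shows "ifo_calls s = (\<Sum>i<k. if i mod q = 0 then n else 2 * q)"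
  using assms
proof (induction k arbitrary: s)
  case (Suc k)
  then obtain s0 where "s0 \<in> set_pmf (run x0 y0 z0 k)" "s \<in> set_pmf (step k s0)" by auto
  thus ?case using Suc.IH step_support(3)[of s k s0, OF _ order_refl] by simp
qed simp

text \<open>The bounded gradient of \<open>f\<close> enters here: \<open>A\<^sup>T z\<close> is the gradient at the previous iterate plus the estimation
  error plus a multiple of the last move.\<close>

lemma run_AL_lower:
  assumes "s \<in> set_pmf (run x0 y0 z0 k)" and k: "1 \<le> k"
  shows "lower_value - 3 * (\<delta>\<^sup>2 + error_sq s + (3/2 * T)\<^sup>2 * move_sq s) / (26 * T) \<le> AL_at s"
proof -
  let ?M = "(1 / \<eta>) *\<^sub>R (G *v (x_cur s - x_prev s))" and ?g = "gradient F (x_prev s)"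
  let ?d = "norm ?g" and ?e = "norm (v_prev s - ?g)" and ?m = "3/2 * T * norm (x_cur s - x_prev s)"
  have "transpose A *v z_cur s = ?g + (v_prev s - ?g) + ?M"
    using run_defect[OF assms(1)] k by (simp add: multiplier_defect_def)
  hence "norm (transpose A *v z_cur s) = norm (?g + (v_prev s - ?g) + ?M)" by (simp only:)
  hence "norm (transpose A *v z_cur s) \<le> ?d + ?e + ?m"
    using norm_triangle_ineq[of "?g + (v_prev s - ?g)" ?M] norm_triangle_ineq[of ?g "v_prev s - ?g"]
      G_upper[of "x_cur s - x_prev s"] by linarith
  hence "(norm (transpose A *v z_cur s))\<^sup>2 \<le> (?d + ?e + ?m)\<^sup>2" by (intro power_mono) auto
  also have "\<dots> \<le> 3 * (?d\<^sup>2 + ?e\<^sup>2 + ?m\<^sup>2)"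
  proof -
    have "0 \<le> (?d - ?e)\<^sup>2 + (?d - ?m)\<^sup>2 + (?e - ?m)\<^sup>2" by simp
    thus ?thesis by (simp add: power2_eq_square algebra_simps)
  qed
  also have "\<dots> \<le> 3 * (\<delta>\<^sup>2 + error_sq s + (3/2 * T)\<^sup>2 * move_sq s)"
    using F_gradient_bound[of "x_prev s"] unfolding error_sq_def move_sq_def power_mult_distrib by simp
  finally have b: "(norm (transpose A *v z_cur s))\<^sup>2 \<le> 3 * (\<delta>\<^sup>2 + error_sq s + (3/2 * T)\<^sup>2 * move_sq s)" .
  have "(norm (transpose A *v z_cur s))\<^sup>2 / (2 * (\<rho> * \<sigma>)) \<le> 3 * (\<delta>\<^sup>2 + error_sq s + (3/2 * T)\<^sup>2 * move_sq s) / (26 * T)"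
    using b rho_sigma T_pos by (intro frac_le) (auto simp: error_sq_def move_sq_def)
  thus ?thesis using AL_lower[of "z_cur s" "x_cur s" "y_cur s"] unfolding AL_at_def by linarith
qed

text \<open>The pathwise inequality of one iteration and the conditional error recursion are averaged over the run; the
  resulting real sequences satisfy the hypotheses of the summation lemma.\<close>

theorem stationarity_sum:
  assumes K: "1 \<le> K"
  shows "\<zeta> * (\<Sum>k=1..K. expected_sq_dist F g m A B c (spider_iterate n fi g m A B c q q \<eta> \<rho> G H x0 y0 z0 k))
    \<le> initial_gap \<rho> F g m A B c x0 y0 z0 + ((norm (transpose A *v z0))\<^sup>2 + \<delta>\<^sup>2) / T"
proof -
  define Ex_k where "Ex_k k \<phi> = measure_pmf.expectation (run x0 y0 z0 k) \<phi>" for k and \<phi> :: "('d, 'p, 'l) spider_state \<Rightarrow> real"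
  define r0 where "r0 k = (if k = 0 then norm (transpose A *v z0) else 0)" for k :: nat
  have int: "integrable (measure_pmf (run x0 y0 z0 k)) \<phi>" for k and \<phi> :: "('d, 'p, 'l) spider_state \<Rightarrow> real"
    by (rule integrable_measure_pmf_finite[OF finite_run])
  have lin: "Ex_k k (\<lambda>s. \<phi> s + \<psi> s) = Ex_k k \<phi> + Ex_k k \<psi>" "Ex_k k (\<lambda>s. \<phi> s - \<psi> s) = Ex_k k \<phi> - Ex_k k \<psi>"
    "Ex_k k (\<lambda>s. a * \<phi> s) = a * Ex_k k \<phi>" "Ex_k k (\<lambda>s. \<phi> s / a) = Ex_k k \<phi> / a" "Ex_k k (\<lambda>s. a) = a" for k \<phi> \<psi> a
    by (simp_all add: Ex_k_def int)
  have mono: "Ex_k k \<phi> \<le> Ex_k k \<psi>" if "\<And>s. s \<in> set_pmf (run x0 y0 z0 k) \<Longrightarrow> \<phi> s \<le> \<psi> s" for k \<phi> \<psi>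
    unfolding Ex_k_def using that by (rule expectation_mono_finite[OF finite_run])
  have next_le: "Ex_k (Suc k) \<phi> \<le> Ex_k k \<psi>"
    if le: "\<And>s. s \<in> set_pmf (run x0 y0 z0 k) \<Longrightarrow> measure_pmf.expectation (step k s) \<phi> \<le> \<psi> s" for k \<phi> \<psi>
  proof -
    have "Ex_k (Suc k) \<phi> = Ex_k k (\<lambda>s. measure_pmf.expectation (step k s) \<phi>)"
      unfolding Ex_k_def by (simp add: expectation_bind_finite finite_run step_eq finite_estimator)
    also have "\<dots> \<le> Ex_k k \<psi>" by (rule mono[OF le])
    finally show ?thesis .
  qed
  have finite_step: "finite (set_pmf (step k s))" for k s by (simp add: step_eq finite_estimator)
  have descent: "Ex_k (Suc k) (\<lambda>s'. AL_at s' + \<zeta> * sdist_sq s' + 5 * T * move_sq s' - (1 / (2 * L) + 1 / (10 * T)) * error_sq s')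
    \<le> Ex_k k (\<lambda>s. AL_at s + 7/5 * T * move_sq s + 1 / (2 * T) * error_sq s + (r0 k)\<^sup>2 / T)" for k
  proof (rule next_le)
    fix s assume s: "s \<in> set_pmf (run x0 y0 z0 k)"
    let ?\<psi> = "AL_at s + 7/5 * T * move_sq s + 1 / (2 * T) * error_sq s + (r0 k)\<^sup>2 / T"
    have "measure_pmf.expectation (step k s) (\<lambda>s'. AL_at s' + \<zeta> * sdist_sq s' + 5 * T * move_sq s'
       - (1 / (2 * L) + 1 / (10 * T)) * error_sq s') \<le> measure_pmf.expectation (step k s) (\<lambda>_. ?\<psi>)"
      by (intro expectation_mono_finite finite_step step_support(2)) (use run_defect[OF s] in \<open>auto simp: r0_def\<close>)
    thus "measure_pmf.expectation (step k s) (\<lambda>s'. AL_at s' + \<zeta> * sdist_sq s' + 5 * T * move_sq s'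
       - (1 / (2 * L) + 1 / (10 * T)) * error_sq s') \<le> ?\<psi>" by simp
  qed
  have rec: "Ex_k (Suc k) error_sq \<le> (if k mod q = 0 then 0 else Ex_k k error_sq + L\<^sup>2 / real q * Ex_k k move_sq)" for k
  proof -
    have "Ex_k (Suc k) error_sq \<le> Ex_k k (\<lambda>s. if k mod q = 0 then 0 else error_sq s + L\<^sup>2 / real q * move_sq s)"
    proof (rule next_le)
      fix s
      have "measure_pmf.expectation (step k s) error_sq
         = measure_pmf.expectation (estimator k s) (\<lambda>(v, calls). (norm (v - gradient F (x_cur s)))\<^sup>2)"
        by (simp add: step_eq error_sq_def successor_def case_prod_beta' Let_def)
      thus "measure_pmf.expectation (step k s) error_sq \<le> (if k mod q = 0 then 0 else error_sq s + L\<^sup>2 / real q * move_sq s)"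
        using estimator_error[of k s] by simp
    qed
    thus ?thesis by (cases "k mod q = 0") (simp_all add: lin)
  qed
  have "\<zeta> * (\<Sum>k=1..K. Ex_k k sdist_sq)
    \<le> Ex_k 0 AL_at - lower_value + (norm (transpose A *v z0))\<^sup>2 / T + \<delta>\<^sup>2 / T"
  proof (rule potential_summation[OF q _ _ L_pos L_le_T _ _ _ _ _ _ K])
    show "0 \<le> Ex_k k error_sq" "0 \<le> Ex_k k move_sq" for k
      unfolding Ex_k_def by (auto intro!: integral_nonneg simp: error_sq_def move_sq_def)
    show "0 \<le> (norm (transpose A *v z0))\<^sup>2 / T" using T_pos by simp
    show "Ex_k (Suc k) AL_at + \<zeta> * Ex_k (Suc k) sdist_sq + 5 * T * Ex_k (Suc k) move_sq
      \<le> Ex_k k AL_at + (1 / (2 * L) + 1 / (10 * T)) * Ex_k (Suc k) error_sq + 7/5 * T * Ex_k k move_sq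
        + 1 / (2 * T) * Ex_k k error_sq + (if k = 0 then (norm (transpose A *v z0))\<^sup>2 / T else 0)" for k
    proof -
      have "(r0 k)\<^sup>2 / T = (if k = 0 then (norm (transpose A *v z0))\<^sup>2 / T else 0)" by (simp add: r0_def)
      thus ?thesis using descent[of k] unfolding lin by linarith
    qed
    show "lower_value - 3 * (\<delta>\<^sup>2 + Ex_k k error_sq + (3/2 * T)\<^sup>2 * Ex_k k move_sq) / (26 * T) \<le> Ex_k k AL_at" if "1 \<le> k" for k
    proof -
      have "Ex_k k (\<lambda>s. lower_value - 3 * (\<delta>\<^sup>2 + error_sq s + (3/2 * T)\<^sup>2 * move_sq s) / (26 * T)) \<le> Ex_k k AL_at"
        by (rule mono[OF run_AL_lower[OF _ that]])
      thus ?thesis unfolding lin .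
    qed
    show "Ex_k (Suc k) error_sq \<le> (if k mod q = 0 then 0 else Ex_k k error_sq + L\<^sup>2 / real q * Ex_k k move_sq)" for k
      by (rule rec)
    show "Ex_k 0 move_sq = 0" "Ex_k 0 error_sq \<le> \<delta>\<^sup>2"
      using F_gradient_bound[of x0] by (simp_all add: Ex_k_def move_sq_def error_sq_def)
  qed
  moreover have "Ex_k k sdist_sq = expected_sq_dist F g m A B c (spider_iterate n fi g m A B c q q \<eta> \<rho> G H x0 y0 z0 k)" for k
    by (simp add: Ex_k_def expected_sq_dist_def spider_iterate_def sdist_sq_def[abs_def])
  moreover have "Ex_k 0 AL_at = AL x0 y0 z0" by (simp add: Ex_k_def AL_at_def)
  ultimately show ?thesis by (simp add: initial_gap_def add_divide_distrib)
qed

lemma expected_sq_dist_output: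
  assumes K: "1 \<le> K"
  shows "expected_sq_dist F g m A B c (spider_output n fi g m A B c q q \<eta> \<rho> G H x0 y0 z0 K)
    = (1 / real K) * (\<Sum>k=1..K. expected_sq_dist F g m A B c (spider_iterate n fi g m A B c q q \<eta> \<rho> G H x0 y0 z0 k))"
  unfolding expected_sq_dist_def spider_output_def
  using K finite_run by (subst pmf_expectation_bind_pmf_of_set) (auto simp: spider_iterate_def sum_distrib_left divide_inverse mult.commute)

text \<open>With \<open>q\<^sup>2 = n\<close>, at most \<open>K / q + 1\<close> full gradients cost \<open>q K + n\<close> calls, and the mini-batches cost \<open>2 q K\<close>.\<close>

lemma ifo_complexity:
  assumes q_sqrt: "real q = sqrt (real n)" and s: "s \<in> set_pmf (run x0 y0 z0 K)"
  shows "real (ifo_calls s) \<le> real n + 3 * sqrt (real n) * real K"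
proof -
  let ?N = "\<Sum>k<K. if k mod q = 0 then (1::nat) else 0"
  have qn: "n = q * q"
  proof -
    have "real n = real (q * q)" using q_sqrt by simp
    thus ?thesis by (simp only: of_nat_eq_iff)
  qed
  have "?N * q \<le> K + q" using sum_reset_cost[OF q, of K] by simp
  hence N: "n * ?N \<le> q * (K + q)" unfolding qn using mult_le_mono2[of "?N * q" "K + q" q] by (simp add: mult.assoc mult.commute)
  have "ifo_calls s = (\<Sum>k<K. if k mod q = 0 then n else 2 * q)" by (rule run_ifo_calls[OF s])
  also have "\<dots> \<le> (\<Sum>k<K. n * (if k mod q = 0 then 1 else 0) + 2 * q)" by (intro sum_mono) auto
  also have "\<dots> = n * ?N + 2 * q * K" by (simp add: sum.distrib sum_distrib_left)
  also have "\<dots> \<le> n + 3 * q * K" using N unfolding qn by (simp add: algebra_simps)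
  finally have "real (ifo_calls s) \<le> real (n + 3 * q * K)" by (rule of_nat_mono)
  thus ?thesis using q_sqrt by simp
qed

end

lemma norm_matrix_le: "onorm ((*v) M) \<le> K \<Longrightarrow> norm (M *v x) \<le> K * norm x" for M :: "real^'n^'m"
  using onorm[OF matrix_vector_mul_bounded_linear, of M x] mult_right_mono[of "onorm ((*v) M)" K "norm x"] by simp

text \<open>The constants are chosen before \<open>n\<close>, \<open>q\<close>, \<open>f\<^sub>i\<close> and \<open>g\<^sub>j\<close>. Since \<open>\<alpha> \<le> 1 \<le> \<kappa>\<^sub>G\<close>, \<open>T = \<kappa>\<^sub>G L / \<alpha>\<close> is at least \<open>L\<close>; the step size
  gives \<open>\<sigma>\<^sub>m\<^sub>i\<^sub>n(G) / \<eta> = 3 L / (2 \<alpha>)\<close> and \<open>\<sigma>\<^sub>m\<^sub>a\<^sub>x(G) / \<eta> = 3 T / 2\<close>, and the penalty gives \<open>\<rho> \<sigma> = sqrt 170 T\<close>.\<close>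

lemma spider_admm_constants:
  fixes A :: "real^'d^'l" and B :: "nat \<Rightarrow> real^'p^'l" and c :: "real^'l"
    and G :: "real^'d^'d" and H :: "nat \<Rightarrow> real^'p^'p"
    and L \<alpha> \<eta> \<rho> :: real
  assumes m: "1 \<le> m" and L: "0 < L"
    and A_full_column_rank: "rank A = CARD('d)"
    and A_range: "\<forall>y. \<exists>x. residual m A B c x y = 0"
    and G: "pos_def G" and H: "\<forall>j\<in>{1..m}. pos_def (H j)"
    and \<alpha>: "0 < \<alpha>" "\<alpha> \<le> 1"
    and \<eta>: "\<eta> = 2 * \<alpha> * sigma_min G / (3 * L)"
    and \<rho>: "\<rho> = sqrt 170 * kappa G * L / (sigma_min (transpose A ** A) * \<alpha>)"
  shows "\<exists>\<sigma> T \<Gamma> \<mu> \<zeta> Cw. \<forall>n q fi g. 1 \<le> n \<and> 1 \<le> q \<and> standing_assumptions L \<delta> n fi m g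
    \<longrightarrow> spider_admm A B c G H m L \<delta> \<eta> \<rho> \<sigma> T \<Gamma> \<mu> \<zeta> Cw n q fi g"
proof -
  define \<sigma> where "\<sigma> = sigma_min (transpose A ** A)"
  define T where "T = kappa G * L / \<alpha>"
  note gram = gram_sigma[OF A_full_column_rank, folded \<sigma>_def]
  note pd = pos_def_sigma[OF G]
  have smax: "0 < sigma_max G" using pd(1,2) by linarith
  have kap: "1 \<le> kappa G" using pd(1,2) by (simp add: kappa_def)
  have "\<alpha> * 1 \<le> 1 * kappa G" using kap \<alpha> by (intro mult_mono) auto
  hence LT: "L \<le> T" using \<alpha> L by (simp add: T_def field_simps)
  have T: "0 < T" using L LT by simp
  have eta: "0 < \<eta>" using \<eta> \<alpha> L pd(1) by simp
  have rs: "\<rho> * \<sigma> = sqrt 170 * T" using \<alpha> gram(1) by (simp add: \<rho> \<sigma>_def[symmetric] T_def)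
  have "sqrt (13\<^sup>2) \<le> sqrt 170" by (intro real_sqrt_le_mono) simp
  hence rs13: "13 * T \<le> \<rho> * \<sigma>" unfolding rs using T by (intro mult_right_mono) auto
  have "0 < \<rho> * \<sigma>" using rs13 T by linarith
  hence rho: "0 < \<rho>" using gram(1) by (simp add: zero_less_mult_iff)
  have G_lower: "L * (norm x)\<^sup>2 \<le> (1 / \<eta>) * wnorm_sq G x" for x
  proof -
    have "(2 * \<alpha>) * (L * (norm x)\<^sup>2) \<le> 3 * (L * (norm x)\<^sup>2)" using \<alpha> L by (intro mult_right_mono) auto
    hence "L * (norm x)\<^sup>2 \<le> (1 / \<eta>) * (sigma_min G * (norm x)\<^sup>2)"
      using \<alpha> L pd(1) by (simp add: \<eta> field_simps)
    also have "\<dots> \<le> (1 / \<eta>) * wnorm_sq G x" using eta pd(3) by (intro mult_left_mono) auto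
    finally show ?thesis .
  qed
  have G_upper: "norm ((1 / \<eta>) *\<^sub>R (G *v x)) \<le> 3 / 2 * T * norm x" for x
  proof -
    have "norm ((1 / \<eta>) *\<^sub>R (G *v x)) = (1 / \<eta>) * norm (G *v x)" using eta by simp
    also have "\<dots> \<le> (1 / \<eta>) * (sigma_max G * norm x)" using eta pd(5) by (intro mult_left_mono) auto
    also have "\<dots> = 3 / 2 * T * norm x" using \<alpha> L pd(1) by (simp add: \<eta> T_def kappa_def field_simps)
    finally show ?thesis .
  qed
  let ?on = "\<lambda>j. onorm ((*v) (B j)) + onorm ((*v) (transpose (B j))) + onorm ((*v) (H j))"
  define \<Gamma> where "\<Gamma> = onorm ((*v) A) + (\<Sum>j=1..m. ?on j)"
  note on0 = onorm_pos_le[OF matrix_vector_mul_bounded_linear]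
  have le: "onorm ((*v) A) \<le> \<Gamma>" "0 \<le> \<Gamma>" by (auto simp: \<Gamma>_def on0 intro!: sum_nonneg add_nonneg_nonneg)
  have lej: "onorm ((*v) (B j)) \<le> \<Gamma>" "onorm ((*v) (transpose (B j))) \<le> \<Gamma>" "onorm ((*v) (H j)) \<le> \<Gamma>"
    if j: "j \<in> {1..m}" for j
  proof -
    have "?on j \<le> (\<Sum>j=1..m. ?on j)" by (intro member_le_sum[OF j]) (auto simp: on0 intro!: add_nonneg_nonneg)
    hence "?on j \<le> \<Gamma>" using on0[of A] unfolding \<Gamma>_def by linarith
    thus "onorm ((*v) (B j)) \<le> \<Gamma>" "onorm ((*v) (transpose (B j))) \<le> \<Gamma>" "onorm ((*v) (H j)) \<le> \<Gamma>"
      using on0[of "B j"] on0[of "transpose (B j)"] on0[of "H j"] by linarith+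
  qed
  define \<mu> where "\<mu> = Min ((\<lambda>j. sigma_min (H j)) ` {1..m})"
  have mu: "0 < \<mu>" using m H pos_def_sigma(1) by (auto simp: \<mu>_def)
  have H_lower: "\<mu> * (norm x)\<^sup>2 \<le> wnorm_sq (H j) x" if j: "j \<in> {1..m}" for j x
  proof -
    have "\<mu> \<le> sigma_min (H j)" unfolding \<mu>_def using j by (intro Min_le) auto
    hence "\<mu> * (norm x)\<^sup>2 \<le> sigma_min (H j) * (norm x)\<^sup>2" by (intro mult_right_mono) auto
    thus ?thesis using pos_def_sigma(3)[of "H j" x] H j by fastforce
  qed
  define Cw where "Cw = real m * (\<rho> * \<Gamma>\<^sup>2 + \<Gamma>)\<^sup>2 * (real m + 1) * (1 + 1 / \<mu>)"
  have Cw0: "0 \<le> Cw" using mu by (simp add: Cw_def)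
  define W where "W = 3 * (L\<^sup>2 + (3 / 2 * T)\<^sup>2) + Cw"
  have W: "0 < W" using L Cw0 by (simp add: W_def add_pos_nonneg)
  define \<zeta> where "\<zeta> = Min {1 / (2 * (Cw + 1)), \<rho> / 10, T / 2 / W, 1 / (30 * T)}"
  have z: "0 < \<zeta>" using Cw0 rho T W by (simp add: \<zeta>_def)
  have zle: "\<zeta> \<le> 1 / (2 * (Cw + 1))" "\<zeta> \<le> \<rho> / 10" "\<zeta> \<le> T / 2 / W" "\<zeta> \<le> 1 / (30 * T)"
    unfolding \<zeta>_def by (intro Min_le; simp)+
  have zCw: "\<zeta> * Cw \<le> 1 / 2"
  proof -
    have "\<zeta> * Cw \<le> 1 / (2 * (Cw + 1)) * Cw" using zle(1) Cw0 by (rule mult_right_mono)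
    also have "\<dots> \<le> 1 / 2" using Cw0 by (simp add: field_simps)
    finally show ?thesis .
  qed
  have zW: "\<zeta> * W \<le> T / 2" using zle(3) W by (simp add: field_simps)
  have zT: "3 * \<zeta> \<le> 1 / (10 * T)" using zle(4) by simp
  have "spider_admm A B c G H m L \<delta> \<eta> \<rho> \<sigma> T \<Gamma> \<mu> \<zeta> Cw n q fi g"
    if "1 \<le> n" "1 \<le> q" "standing_assumptions L \<delta> n fi m g" for n q fi g
  proof -
    have range: "\<exists>x. residual m A B c x y = 0" for y using A_range by blast
    have H': "pos_def (H j)" if "j \<in> {1..m}" for j using H that by blast
    have A_upper: "norm (A *v x) \<le> \<Gamma> * norm x" for x by (rule norm_matrix_le[OF le(1)])
    have B_upper: "norm (B j *v x) \<le> \<Gamma> * norm x" if "j \<in> {1..m}" for j x by (rule norm_matrix_le[OF lej(1)[OF that]])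
    have Bt_upper: "norm (transpose (B j) *v x) \<le> \<Gamma> * norm x" if "j \<in> {1..m}" for j x by (rule norm_matrix_le[OF lej(2)[OF that]])
    have H_upper: "norm (H j *v x) \<le> \<Gamma> * norm x" if "j \<in> {1..m}" for j x by (rule norm_matrix_le[OF lej(3)[OF that]])
    show ?thesis
      by (rule spider_admm.intro)
        (fact L LT gram range eta G G_lower G_upper H' rho rs13 le(2) A_upper B_upper Bt_upper H_upper mu H_lower
          Cw_def z zCw zle(2) zW[unfolded W_def] zT that)+
  qed
  thus ?thesis by blast
qed

theorem mainTheorem5:
  fixes A :: "real^'d^'l" and B :: "nat \<Rightarrow> real^'p^'l" and c :: "real^'l"
    and G :: "real^'d^'d" and H :: "nat \<Rightarrow> real^'p^'p" and m :: nat
    and L \<delta> \<Delta> \<alpha> \<eta> \<rho> :: real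
    and x0 :: "real^'d" and y0 :: "nat \<Rightarrow> real^'p" and z0 :: "real^'l"
  assumes m: "1 \<le> m" and L: "0 < L" and \<delta>: "0 < \<delta>"
    and A_full_column_rank: "rank A = CARD('d)"
    and A_range: "\<forall>y. \<exists>x. residual m A B c x y = 0"
    and G: "pos_def G" and H: "\<forall>j\<in>{1..m}. pos_def (H j)"
    and \<alpha>: "0 < \<alpha>" "\<alpha> \<le> 1"
    and \<eta>: "\<eta> = 2 * \<alpha> * sigma_min G / (3 * L)"
    and \<rho>: "\<rho> = sqrt 170 * kappa G * L / (sigma_min (transpose A ** A) * \<alpha>)"
  shows
    "(\<exists>C. \<forall>n fi g b q K.
        1 \<le> n \<and> 1 \<le> b \<and> b = q \<and> 1 \<le> K \<and>
        standing_assumptions L \<delta> n fi m g \<and>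
        initial_gap \<rho> (favg n fi) g m A B c x0 y0 z0 \<le> \<Delta> \<longrightarrow>
        (1 / real K) * (\<Sum>k=1..K. expected_sq_dist (favg n fi) g m A B c
            (spider_iterate n fi g m A B c b q \<eta> \<rho> G H x0 y0 z0 k)) \<le> C / real K)
     \<and>
     (\<exists>C. \<forall>n b q \<epsilon>.
        1 \<le> n \<and> b = q \<and> real q = sqrt (real n) \<and> 0 < \<epsilon> \<longrightarrow>
        (\<exists>K\<ge>1. \<forall>fi g.
           standing_assumptions L \<delta> n fi m g \<and>
           initial_gap \<rho> (favg n fi) g m A B c x0 y0 z0 \<le> \<Delta> \<longrightarrow>
           approx_stationary \<epsilon> (favg n fi) g m A B c
             (spider_output n fi g m A B c b q \<eta> \<rho> G H x0 y0 z0 K) \<and>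
           (\<forall>s \<in> set_pmf (spider_run n fi g m A B c b q \<eta> \<rho> G H x0 y0 z0 K).
              real (ifo_calls s) \<le> C * (real n + sqrt (real n) / \<epsilon>))))
     \<and>
     (\<alpha> = 1 \<longrightarrow> \<eta> = 2 * sigma_min G / (3 * L) \<and>
        \<rho> = sqrt 170 * kappa G * L / sigma_min (transpose A ** A))"
proof -
  obtain \<sigma> T \<Gamma> \<mu> \<zeta> Cw where loc: "\<And>n q fi g. 1 \<le> n \<Longrightarrow> 1 \<le> q \<Longrightarrow> standing_assumptions L \<delta> n fi m g \<Longrightarrow>
      spider_admm A B c G H m L \<delta> \<eta> \<rho> \<sigma> T \<Gamma> \<mu> \<zeta> Cw n q fi g"
    using spider_admm_constants[OF m L A_full_column_rank A_range G H \<alpha> \<eta> \<rho>] by metis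
  define C1 where "C1 = \<bar>(\<Delta> + ((norm (transpose A *v z0))\<^sup>2 + \<delta>\<^sup>2) / T) / \<zeta>\<bar>"
  have rate: "(\<Sum>k=1..K. expected_sq_dist (favg n fi) g m A B c
            (spider_iterate n fi g m A B c q q \<eta> \<rho> G H x0 y0 z0 k)) \<le> C1"
    if "1 \<le> n" "1 \<le> q" "1 \<le> K" "standing_assumptions L \<delta> n fi m g"
      "initial_gap \<rho> (favg n fi) g m A B c x0 y0 z0 \<le> \<Delta>" for n fi g q K
  proof -
    interpret spider_admm A B c G H m L \<delta> \<eta> \<rho> \<sigma> T \<Gamma> \<mu> \<zeta> Cw n q fi g by (rule loc[OF that(1,2,4)])
    have "(\<Sum>k=1..K. expected_sq_dist (favg n fi) g m A B c
            (spider_iterate n fi g m A B c q q \<eta> \<rho> G H x0 y0 z0 k))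
       \<le> (\<Delta> + ((norm (transpose A *v z0))\<^sup>2 + \<delta>\<^sup>2) / T) / \<zeta>"
      using stationarity_sum[OF that(3), of x0 y0 z0] that(5) zeta_pos by (simp add: field_simps)
    thus ?thesis unfolding C1_def by linarith
  qed
  have part1: "(1 / real K) * (\<Sum>k=1..K. expected_sq_dist (favg n fi) g m A B c
            (spider_iterate n fi g m A B c b q \<eta> \<rho> G H x0 y0 z0 k)) \<le> C1 / real K"
    if "1 \<le> n \<and> 1 \<le> b \<and> b = q \<and> 1 \<le> K \<and> standing_assumptions L \<delta> n fi m g \<and>
        initial_gap \<rho> (favg n fi) g m A B c x0 y0 z0 \<le> \<Delta>" for n fi g b q K
    using rate[of n q K fi g] that by (simp add: divide_right_mono)
  have part2: "\<exists>K\<ge>1. \<forall>fi g.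
           standing_assumptions L \<delta> n fi m g \<and>
           initial_gap \<rho> (favg n fi) g m A B c x0 y0 z0 \<le> \<Delta> \<longrightarrow>
           approx_stationary \<epsilon> (favg n fi) g m A B c
             (spider_output n fi g m A B c b q \<eta> \<rho> G H x0 y0 z0 K) \<and>
           (\<forall>s \<in> set_pmf (spider_run n fi g m A B c b q \<eta> \<rho> G H x0 y0 z0 K).
              real (ifo_calls s) \<le> (7 + 3 * C1) * (real n + sqrt (real n) / \<epsilon>))"
    if h: "1 \<le> n \<and> b = q \<and> real q = sqrt (real n) \<and> 0 < \<epsilon>" for n b q \<epsilon>
  proof -
    have n: "1 \<le> n" and qs: "real q = sqrt (real n)" and \<epsilon>: "0 < \<epsilon>" and b: "b = q" using h by auto
    have "1 \<le> real q" unfolding qs using n by simp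
    hence q: "1 \<le> q" by simp
    have C1: "0 \<le> C1" by (simp add: C1_def)
    \<comment> \<open>The additional \<open>1\<close> keeps \<open>K\<close> positive when \<open>C1 = 0\<close>.\<close>
    define K where "K = nat \<lceil>C1 / \<epsilon>\<rceil> + 1"
    have K: "1 \<le> K" "C1 / \<epsilon> \<le> real K" "real K \<le> C1 / \<epsilon> + 2"
      using C1 \<epsilon> by (auto simp: K_def) linarith+
    have budget: "real n + 3 * sqrt (real n) * real K \<le> (7 + 3 * C1) * (real n + sqrt (real n) / \<epsilon>)"
    proof -
      have sq: "sqrt (real n) \<le> real n" using n by (simp add: real_le_lsqrt power2_eq_square)
      have "3 * sqrt (real n) * real K \<le> 3 * sqrt (real n) * (C1 / \<epsilon> + 2)" by (intro mult_left_mono K) auto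
      also have "\<dots> = 3 * C1 * (sqrt (real n) / \<epsilon>) + 6 * sqrt (real n)" by (simp add: algebra_simps)
      finally have "real n + 3 * sqrt (real n) * real K \<le> 7 * real n + 3 * C1 * (sqrt (real n) / \<epsilon>)" using sq by linarith
      moreover have "0 \<le> 3 * C1 * real n" "0 \<le> sqrt (real n) / \<epsilon>" using C1 \<epsilon> by auto
      moreover have "(7 + 3 * C1) * (real n + sqrt (real n) / \<epsilon>)
          = 7 * real n + 3 * C1 * real n + 7 * (sqrt (real n) / \<epsilon>) + 3 * C1 * (sqrt (real n) / \<epsilon>)"
        by (simp add: algebra_simps)
      ultimately show ?thesis by linarith
    qed
    show ?thesis
    proof (intro exI[of _ K] conjI allI impI ballI K(1))
      fix fi g
      assume fg: "standing_assumptions L \<delta> n fi m g \<and> initial_gap \<rho> (favg n fi) g m A B c x0 y0 z0 \<le> \<Delta>"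
      interpret spider_admm A B c G H m L \<delta> \<eta> \<rho> \<sigma> T \<Gamma> \<mu> \<zeta> Cw n q fi g using loc[OF n q] fg by blast
      have "(1 / real K) * (\<Sum>k=1..K. expected_sq_dist (favg n fi) g m A B c
            (spider_iterate n fi g m A B c q q \<eta> \<rho> G H x0 y0 z0 k)) \<le> (1 / real K) * C1"
        using fg by (intro mult_left_mono rate n q K(1)) auto
      also have "\<dots> \<le> \<epsilon>" using K(1,2) \<epsilon> by (simp add: field_simps)
      finally show "approx_stationary \<epsilon> (favg n fi) g m A B c (spider_output n fi g m A B c b q \<eta> \<rho> G H x0 y0 z0 K)"
        unfolding approx_stationary_def b expected_sq_dist_output[OF K(1)] .
      fix s assume "s \<in> set_pmf (spider_run n fi g m A B c b q \<eta> \<rho> G H x0 y0 z0 K)"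
      thus "real (ifo_calls s) \<le> (7 + 3 * C1) * (real n + sqrt (real n) / \<epsilon>)"
        using ifo_complexity[OF qs, of s x0 y0 z0 K] budget unfolding b by linarith
    qed
  qed
  show ?thesis
  proof (intro conjI[OF _ conjI], goal_cases)
    case 1
    show ?case by (rule exI[of _ C1]) (intro allI impI, rule part1)
  next
    case 2
    show ?case by (rule exI[of _ "7 + 3 * C1"]) (intro allI impI, rule part2)
  next
    case 3
    show ?case using \<eta> \<rho> by simp
  qed
qed

end
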